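(* Let $n\ge 2$. Let $\omega_\Sigma:\mathbb{R}\to[0,\infty)$ be continuous, with $\omega_\Sigma(0)=0$, smooth on $\mathbb{R}\setminus\{0\}$, and such that $0$ is its only zero. Let $\Sigma$ be the rotationally symmetric pinching cylinder in $\mathbb{R}^{n+1}$ with profile $\omega_\Sigma$. Assume that there is a constant $C_\Sigma\ge 0$ such that $$\langle \nu_\Sigma(z),e_1\rangle > C_\Sigma\quad\text{for all } z\in\mathbb{R}$$ (at $z=0$ understood as limits from above and below), and that $$z\,\frac{d\omega_\Sigma}{dz}(z)>0\quad\text{for all } z\in\mathbb{R}\setminus\{0\}.$$ Let $\omega_0$ be admissible initial data, and let $\omega:D(t)\times[0,T)\to\mathbb{R}$, $D(t)=(0,r(t))$, be the solution on its maximal time interval of the graphical, rotationally symmetric mean curvature flow with free boundary on $\Sigma$ and initial data $\omega_0$. Let $F:D^n\times[0,T)\to\mathbb{R}^{n+1}$ be the generated family of rotationally symmetric hypersurfaces, with second fundamental form $A$. (Here $T<\infty$ and the hypersurfaces contract to the point $(0,0)$ as $t\to T$.) Suppose that there exist constants $C_1,C_2,C_3\in\mathbb{R}$ with $0<C_1<\infty$, $C_1<C_2<\infty$, $0<C_3<\infty$, and constants $\alpha,\delta\in(0,\infty)$ satisfying $\frac{2\delta}{\alpha+1}>1$, such that for all $z\neq 0$ sufficiently close to $0$ $$\frac{C_1}{|z|^\delta}\le\left|\frac{\frac{d\omega_\Sigma}{dz}(z)}{\omega_\Sigma(z)}\right|\le\frac{C_2}{|z|^\alpha}\qquad\text{and}\qquad\left|\frac{d\omega_\Sigma}{dz}(z)\right|\le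 C_3 .$$ Then the singularity of the flow at time $T$ is Type 2. In particular, there exists $C\in(0,\infty)$ such that for all $t<T$ sufficiently close to $T$ $$\sup_{x\in D^n}|A|^2(x,t)\ \ge\ \frac{C}{(T-t)^{\frac{2\delta}{\alpha+1}}}\,.$$
   Context: **Coordinates.** Write points of $\mathbb{R}^{n+1}$ as $(x,z)$ with $x\in\mathbb{R}^n$, $z\in\mathbb{R}$, and put $y=|x|$. The $z$-axis $Oz$ is the axis of rotation. Profile curves lie in the $(y,z)$-half-plane, and $e_1$ is the unit vector in the $y$-direction. $D^n$ is the $n$-dimensional disk. **Pinching cylinder (with one pinching point at $0$).** The support hypersurface $\Sigma$ is generated by rotating the curve $\{(y,z): y=\omega_\Sigma(z)\}$ about $Oz$, where $\omega_\Sigma:Oz\to[0,\infty)$ is continuous, is smooth away from its single zero $z=0$, and satisfies $z\,\omega_\Sigma'(z)>0$ outside some compact set containing $0$. Its unit normal in $(y,z)$-coordinates is $$\nu_\Sigma(z)=\frac{1}{\sqrt{1+(\omega_\Sigma'(z))^2}}\,\bigl(1,-\omega_\Sigma'(z)\bigr).$$ **The flow.** A rotationally symmetric graphical mean curvature flow with free boundary on $\Sigma$ is given by functions $r(t)>0$ and $\omega(\cdot,t):(0,r(t))\to\mathbb{R}$, $t\in[0,T)$, satisfying $$\frac{\partial\omega}{\partial t}=\frac{d^2\omega}{dy^2}\,\frac{1}{1+(\frac{d\omega}{dy})^2}+\frac{n-1}{y}\,\frac{d\omega}{dy}\quad\text{on }(0,r(t))\times[0,T),$$ with boundary conditions at $y=r(t)$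 $$\langle\nu_\omega,\nu_\Sigma\rangle=0\quad\text{and}\quad r(t)=\omega_\Sigma(\omega(r(t),t)),$$ where $\nu_\omega=\frac{1}{\sqrt{1+(d\omega/dy)^2}}\bigl(-\frac{d\omega}{dy},1\bigr)$ and $\nu_\Sigma$ is evaluated at $z=\omega(r(t),t)$. The orthogonality condition is equivalent to $\frac{d\omega}{dy}(r(t),t)=-\omega_\Sigma'(\omega(r(t),t))$. In addition, $\lim_{y\to0}\frac1y\frac{d\omega}{dy}(y,t)$ exists and $\omega(\cdot,0)=\omega_0$. The hypersurface $F(D^n,t)$ is $\{(x,\omega(|x|,t)):|x|\le r(t)\}$. The family $F$ moves by mean curvature ($\partial_tF=\vec H$, up to tangential reparametrisation), meets $\Sigma$ orthogonally along its boundary, and has its boundary on $\Sigma$. **Admissible initial data.** $\omega_0\in C^2((0,r(0)))$, satisfying the same boundary conditions at $y=r(0)$: $\langle\nu_{\omega_0},\nu_\Sigma\rangle=0$ and $r(0)=\omega_\Sigma(\omega_0(r(0)))$. **Known background fact.** Under the stated hypotheses on $\Sigma$ (the graph condition $\langle\nu_\Sigma,e_1\rangle>C_\Sigma\ge0$ and $z\,\omega_\Sigma'(z)>0$ for $z\ne0$), the maximal existence time $T$ of any such flow is finite and the hypersurfaces contract to the point $(0,0)$ as $t\to T$. "The singularity" means this singularity at time $T$. **Singularity types.** - The singularity at time $T$ is Type 0 if there exist $\varepsilon>0$ and $C<\infty$ with $|A|^2(x,t)\le C$ for all $x\in D^n$, $t\in(T-\varepsilon,T)$. - It is Type 1 if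 there exist $\varepsilon>0$ and $C<\infty$ with $|A|^2(x,t)\le\frac{C}{T-t}$ for all $x\in D^n$, $t\in(T-\varepsilon,T)$. - It is Type 2 if neither of these holds. *)

theory Defs
  imports "HOL-Analysis.Analysis"
begin

subsection \<open>Regularity of functions of one real variable\<close>

text \<open>Derivatives are taken within the set, hence one-sided at an end point belonging to it.\<close>

definition C1_on :: "(real \<Rightarrow> real) \<Rightarrow> real set \<Rightarrow> bool" where
  "C1_on f S \<longleftrightarrow>
     (\<forall>x\<in>S. f differentiable (at x within S)) \<and>
     continuous_on S (\<lambda>x. vector_derivative f (at x within S))"

definition C2_on :: "(real \<Rightarrow> real) \<Rightarrow> real set \<Rightarrow> bool" where
  "C2_on f S \<longleftrightarrow>
     (\<forall>x\<in>S. f differentiable (at x within S)) \<and>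
     C1_on (\<lambda>x. vector_derivative f (at x within S)) S"

text \<open>Meant for open sets.\<close>

definition smooth_on :: "(real \<Rightarrow> real) \<Rightarrow> real set \<Rightarrow> bool" where
  "smooth_on f S \<longleftrightarrow> (\<forall>k. \<forall>x\<in>S. ((deriv ^^ k) f) field_differentiable (at x))"


subsection \<open>The support hypersurface\<close>

text \<open>
  \<open>\<omega>\<Sigma>\<close> is the profile of the support hypersurface \<open>{(x, z). norm x = \<omega>\<Sigma> z}\<close>.
  Vectors of the profile half-plane are pairs \<open>(y, z)\<close>.
\<close>

definition pinching_cylinder :: "(real \<Rightarrow> real) \<Rightarrow> bool" where
  "pinching_cylinder \<omega>\<Sigma> \<longleftrightarrow>
     continuous_on UNIV \<omega>\<Sigma> \<and> (\<forall>z. 0 \<le> \<omega>\<Sigma> z) \<and> (\<forall>z. \<omega>\<Sigma> z = 0 \<longleftrightarrow> z = 0) \<and>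
     smooth_on \<omega>\<Sigma> (- {0}) \<and>
     (\<exists>K. compact K \<and> 0 \<in> K \<and> (\<forall>z. z \<notin> K \<longrightarrow> z * deriv \<omega>\<Sigma> z > 0))"

definition normal_Sigma :: "(real \<Rightarrow> real) \<Rightarrow> real \<Rightarrow> real \<times> real" where
  "normal_Sigma \<omega>\<Sigma> z = (1 / sqrt (1 + (deriv \<omega>\<Sigma> z)\<^sup>2)) *\<^sub>R (1, - deriv \<omega>\<Sigma> z)"

definition e1 :: "real \<times> real" where
  "e1 = (1, 0)"

text \<open>At \<open>z = 0\<close> the profile need not be differentiable; there the bound is imposed on the
  two one-sided limits, whose existence is part of the condition.\<close>

definition graph_condition :: "(real \<Rightarrow> real) \<Rightarrow> real \<Rightarrow> bool" where
  "graph_condition \<omega>\<Sigma> C \<longleftrightarrow>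
     (\<forall>z. z \<noteq> 0 \<longrightarrow> normal_Sigma \<omega>\<Sigma> z \<bullet> e1 > C) \<and>
     (\<exists>l. ((\<lambda>z. normal_Sigma \<omega>\<Sigma> z \<bullet> e1) \<longlongrightarrow> l) (at_right 0) \<and> l > C) \<and>
     (\<exists>l. ((\<lambda>z. normal_Sigma \<omega>\<Sigma> z \<bullet> e1) \<longlongrightarrow> l) (at_left 0) \<and> l > C)"


subsection \<open>The flow\<close>

definition graph_normal :: "real \<Rightarrow> real \<times> real" where
  "graph_normal p = (1 / sqrt (1 + p\<^sup>2)) *\<^sub>R (- p, 1)"

text \<open>
  Free boundary condition at \<open>y = \<rho>\<close> for the graph of \<open>f\<close> over \<open>(0, \<rho>]\<close>; the slope at \<open>\<rho>\<close> is
  the one-sided derivative.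
\<close>

definition free_boundary :: "(real \<Rightarrow> real) \<Rightarrow> real \<Rightarrow> (real \<Rightarrow> real) \<Rightarrow> bool" where
  "free_boundary \<omega>\<Sigma> \<rho> f \<longleftrightarrow>
     f differentiable (at \<rho> within {0<..\<rho>}) \<and>
     graph_normal (vector_derivative f (at \<rho> within {0<..\<rho>})) \<bullet> normal_Sigma \<omega>\<Sigma> (f \<rho>) = 0 \<and>
     \<rho> = \<omega>\<Sigma> (f \<rho>)"

definition admissible_data :: "(real \<Rightarrow> real) \<Rightarrow> real \<Rightarrow> (real \<Rightarrow> real) \<Rightarrow> bool" where
  "admissible_data \<omega>\<Sigma> r0 \<omega>0 \<longleftrightarrow>
     r0 > 0 \<and> C2_on \<omega>0 {0<..<r0} \<and> free_boundary \<omega>\<Sigma> r0 \<omega>0"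

text \<open>
  A classical solution on the time interval \<open>[0, T)\<close>.  The function \<open>\<omega>(\<cdot>, t)\<close> on \<open>(0, r(t))\<close> is
  identified with its continuous extension to \<open>[0, r(t)]\<close>, which gives meaning to the boundary
  conditions and to the hypersurface at \<open>x = 0\<close>.  Values of \<open>\<omega>\<close> outside
  \<open>{(y, t). 0 \<le> y \<le> r(t), 0 \<le> t < T}\<close> are irrelevant: \<open>r\<close> is continuous, so the time derivative
  at an interior point only sees values inside this set (it is one-sided at \<open>t = 0\<close>).
  At positive times the hypersurface is \<open>C\<^sup>2\<close> up to its boundary; at \<open>t = 0\<close> only the interior
  regularity of admissible data is required.
\<close>

definition free_boundary_mcf ::
  "nat \<Rightarrow> (real \<Rightarrow> real) \<Rightarrow> real \<Rightarrow> (real \<Rightarrow> real) \<Rightarrow> (real \<Rightarrow> real \<Rightarrow> real) \<Rightarrow> bool" where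
  "free_boundary_mcf n \<omega>\<Sigma> T r \<omega> \<longleftrightarrow>
     0 < T \<and>
     (\<forall>t\<in>{0..<T}. 0 < r t) \<and>
     continuous_on {0..<T} r \<and>
     continuous_on {(y, t). 0 \<le> y \<and> y \<le> r t \<and> 0 \<le> t \<and> t < T} (\<lambda>(y, t). \<omega> y t) \<and>
     (\<forall>t\<in>{0..<T}. C1_on (\<lambda>y. \<omega> y t) {0<..r t} \<and> C2_on (\<lambda>y. \<omega> y t) {0<..<r t}) \<and>
     (\<forall>t\<in>{0<..<T}. C2_on (\<lambda>y. \<omega> y t) {0<..r t}) \<and>
     (\<forall>t\<in>{0..<T}. \<forall>y\<in>{0<..<r t}.
        ((\<lambda>s. \<omega> y s) has_real_derivative
           (deriv (deriv (\<lambda>\<eta>. \<omega> \<eta> t)) y * (1 / (1 + (deriv (\<lambda>\<eta>. \<omega> \<eta> t) y)\<^sup>2))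
            + (real n - 1) / y * deriv (\<lambda>\<eta>. \<omega> \<eta> t) y)) (at t within {0..<T})) \<and>
     (\<forall>t\<in>{0..<T}. free_boundary \<omega>\<Sigma> (r t) (\<lambda>y. \<omega> y t)) \<and>
     (\<forall>t\<in>{0..<T}. \<exists>l. ((\<lambda>y. 1 / y * deriv (\<lambda>\<eta>. \<omega> \<eta> t) y) \<longlongrightarrow> l) (at_right 0))"

definition maximal_free_boundary_mcf ::
  "nat \<Rightarrow> (real \<Rightarrow> real) \<Rightarrow> real \<Rightarrow> (real \<Rightarrow> real) \<Rightarrow> (real \<Rightarrow> real \<Rightarrow> real) \<Rightarrow> bool" where
  "maximal_free_boundary_mcf n \<omega>\<Sigma> T r \<omega> \<longleftrightarrow>
     free_boundary_mcf n \<omega>\<Sigma> T r \<omega> \<and>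
     \<not> (\<exists>T' r' \<omega>'. T < T' \<and> free_boundary_mcf n \<omega>\<Sigma> T' r' \<omega>' \<and>
          (\<forall>t\<in>{0..<T}. r' t = r t \<and> (\<forall>y\<in>{0..r t}. \<omega>' y t = \<omega> y t)))"

text \<open>
  The generated hypersurfaces, parametrised over the unit disk \<open>cball 0 1\<close> so that the parameter
  domain does not depend on time; the image at time \<open>t\<close> is
  \<open>{(x, \<omega>(|x|, t)). |x| \<le> r(t)}\<close>.
\<close>

definition hypersurface ::
  "(real \<Rightarrow> real) \<Rightarrow> (real \<Rightarrow> real \<Rightarrow> real) \<Rightarrow> real ^ 'n \<Rightarrow> real \<Rightarrow> (real ^ 'n) \<times> real" where
  "hypersurface r \<omega> x t = (r t *\<^sub>R x, \<omega> (r t * norm x) t)"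


subsection \<open>The second fundamental form\<close>

text \<open>For a parametrisation \<open>F\<close> of a hypersurface over a set \<open>S\<close>; derivatives are taken within \<open>S\<close>,
  hence one-sided at boundary points of the disk.\<close>

definition partial_within ::
  "(real ^ 'n) set \<Rightarrow> 'n \<Rightarrow> (real ^ 'n \<Rightarrow> 'b::real_normed_vector) \<Rightarrow> real ^ 'n \<Rightarrow> 'b" where
  "partial_within S i F x = frechet_derivative F (at x within S) (axis i 1)"

definition first_ff ::
  "(real ^ 'n) set \<Rightarrow> (real ^ 'n \<Rightarrow> (real ^ 'n) \<times> real) \<Rightarrow> real ^ 'n \<Rightarrow> real ^ 'n ^ 'n" where
  "first_ff S F x = (\<chi> i j. partial_within S i F x \<bullet> partial_within S j F x)"

text \<open>For graphs over \<open>\<real>\<^sup>n\<close> the unit normal is normalised to point upwards, as \<open>graph_normal\<close> does.\<close>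

definition upward_normal ::
  "(real ^ 'n) set \<Rightarrow> (real ^ 'n \<Rightarrow> (real ^ 'n) \<times> real) \<Rightarrow> real ^ 'n \<Rightarrow> (real ^ 'n) \<times> real" where
  "upward_normal S F x =
     (THE \<nu>. norm \<nu> = 1 \<and> (\<forall>i. \<nu> \<bullet> partial_within S i F x = 0) \<and> snd \<nu> > 0)"

definition second_ff ::
  "(real ^ 'n) set \<Rightarrow> (real ^ 'n \<Rightarrow> (real ^ 'n) \<times> real) \<Rightarrow> real ^ 'n \<Rightarrow> real ^ 'n ^ 'n" where
  "second_ff S F x =
     (\<chi> i j. partial_within S i (partial_within S j F) x \<bullet> upward_normal S F x)"

definition second_ff_norm_sq ::
  "(real ^ 'n) set \<Rightarrow> (real ^ 'n \<Rightarrow> (real ^ 'n) \<times> real) \<Rightarrow> real ^ 'n \<Rightarrow> real" where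
  "second_ff_norm_sq S F x =
     (let h = matrix_inv (first_ff S F x); A = second_ff S F x
      in \<Sum>i\<in>UNIV. \<Sum>j\<in>UNIV. \<Sum>k\<in>UNIV. \<Sum>l\<in>UNIV. h $ i $ k * h $ j $ l * A $ i $ j * A $ k $ l)"

definition A_norm_sq :: "(real ^ 'n \<Rightarrow> real \<Rightarrow> (real ^ 'n) \<times> real) \<Rightarrow> real ^ 'n \<Rightarrow> real \<Rightarrow> real" where
  "A_norm_sq F x t = second_ff_norm_sq (cball 0 1) (\<lambda>x. F x t) x"


subsection \<open>Singularity types\<close>

definition type0_singularity ::
  "(real ^ 'n \<Rightarrow> real \<Rightarrow> (real ^ 'n) \<times> real) \<Rightarrow> real \<Rightarrow> bool" where
  "type0_singularity F T \<longleftrightarrow>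
     (\<exists>\<epsilon>>0. \<exists>C. \<forall>x\<in>cball 0 1. \<forall>t\<in>{T - \<epsilon><..<T}. A_norm_sq F x t \<le> C)"

definition type1_singularity ::
  "(real ^ 'n \<Rightarrow> real \<Rightarrow> (real ^ 'n) \<times> real) \<Rightarrow> real \<Rightarrow> bool" where
  "type1_singularity F T \<longleftrightarrow>
     (\<exists>\<epsilon>>0. \<exists>C. \<forall>x\<in>cball 0 1. \<forall>t\<in>{T - \<epsilon><..<T}. A_norm_sq F x t \<le> C / (T - t))"

definition type2_singularity ::
  "(real ^ 'n \<Rightarrow> real \<Rightarrow> (real ^ 'n) \<times> real) \<Rightarrow> real \<Rightarrow> bool" where
  "type2_singularity F T \<longleftrightarrow> \<not> type0_singularity F T \<and> \<not> type1_singularity F T"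

end

theory Submission
  imports Defs
begin

text \<open>
  Let \<open>z(t) = \<omega>(r(t), t)\<close> be the height of the contact circle; it never vanishes, and after a
  reflection \<open>z > 0\<close>, so that the slope at the contact circle is negative. One principal
  curvature there has absolute value \<open>b'(z) / (b(z) sqrt (1 + b'(z)\<^sup>2))\<close> with \<open>b = \<omega>\<Sigma>\<close>, so \<open>|A|\<^sup>2\<close> is
  bounded below by a multiple of \<open>z powr (- 2 \<delta>)\<close>, and it suffices to show
  \<open>z(t) powr (\<alpha> + 1) \<le> C (T - t)\<close>.

  A two-point maximum principle preserves an upper bound on the slope of \<open>\<omega>\<close>. Since
  \<open>r \<le> (C3 / C1) z powr \<delta>\<close> with \<open>\<delta> > 1\<close>, the graph therefore lies above \<open>z(s) / 2\<close> at every late time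
  \<open>s\<close>. From time \<open>s\<close> on, as long as \<open>z \<ge> z(s) / 8\<close>, the paraboloids
  \<open>z(s) / 2 - n K (t - s) - K y\<^sup>2 / 2\<close> with \<open>K\<close> of order \<open>z(s) powr (- \<alpha>)\<close> are barriers from below,
  because the slope at the contact circle is at least \<open>- C2 r / z powr \<alpha>\<close>. Hence \<open>z\<close> needs a time
  of order \<open>z(s) powr (\<alpha> + 1)\<close> to drop to \<open>z(s) / 8\<close>. Both comparison arguments work with the first two
  derivatives of \<open>\<omega>\<close> alone, so no parabolic regularity theory enters.
\<close>

subsection \<open>Maximum principles\<close>

lemma local_max_second_deriv_nonpos:
  fixes f f' :: "real \<Rightarrow> real"
  assumes "a < x" "x < b"
    and f: "\<And>u. a < u \<Longrightarrow> u < b \<Longrightarrow> (f has_real_derivative f' u) (at u)"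
    and f': "(f' has_real_derivative d) (at x)"
    and max: "\<And>u. a < u \<Longrightarrow> u < b \<Longrightarrow> f u \<le> f x"
  shows "f' x = 0" "d \<le> 0"
proof -
  show 0: "f' x = 0"
    by (rule DERIV_local_max[OF f[OF assms(1,2)], of "min (x - a) (b - x)"])
      (use assms in \<open>auto intro!: max\<close>)
  show "d \<le> 0"
  proof (rule ccontr)
    assume "\<not> d \<le> 0"
    then obtain e where e: "e > 0" "\<And>h. 0 < h \<Longrightarrow> h < e \<Longrightarrow> f' x < f' (x + h)"
      using has_real_derivative_pos_inc_right[OF f'] by auto
    define h where "h = min e (b - x) / 2"
    have h: "0 < h" "h < e" "x + h < b"
      using e assms(2) by (auto simp: h_def min_def field_simps)
    obtain u where u: "x < u" "u < x + h" "f (x + h) - f x = (x + h - x) * f' u"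
      using MVT2[of x "x + h" f f'] f h assms(1) by force
    have "f' u > 0"
      using e(2)[of "u - x"] u h 0 by auto
    then have "h * f' u > 0"
      using h(1) by simp
    then have "f (x + h) > f x"
      using u(3) by simp
    then show False
      using max[of "x + h"] h assms(1) by auto
  qed
qed

lemma local_min_second_deriv_nonneg:
  fixes f f' :: "real \<Rightarrow> real"
  assumes "a < x" "x < b"
    and f: "\<And>u. a < u \<Longrightarrow> u < b \<Longrightarrow> (f has_real_derivative f' u) (at u)"
    and f': "(f' has_real_derivative d) (at x)"
    and min: "\<And>u. a < u \<Longrightarrow> u < b \<Longrightarrow> f x \<le> f u"
  shows "f' x = 0" "d \<ge> 0"
  using local_max_second_deriv_nonpos[of a x b "\<lambda>u. - f u" "\<lambda>u. - f' u" "- d"] assms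
  by (auto intro!: DERIV_minus)

text \<open>At an extremum of a comparison function only earlier times are compared. The margin
  \<open>e\<close> is there because a fixed radius is known to lie inside the moving domain only at
  times near \<open>t\<close>.\<close>

lemma deriv_nonneg_of_left_max:
  fixes g :: "real \<Rightarrow> real"
  assumes g: "(g has_real_derivative d) (at t within {0..<T})"
    and "0 \<le> t0" "t0 < t" "t < T" "e > 0"
    and max: "\<And>s. t0 \<le> s \<Longrightarrow> s \<le> t \<Longrightarrow> t - e < s \<Longrightarrow> g s \<le> g t"
  shows "d \<ge> 0"
proof (rule ccontr)
  assume "\<not> d \<ge> 0"
  then obtain c where c: "c > 0" "\<And>h. 0 < h \<Longrightarrow> t - h \<in> {0..<T} \<Longrightarrow> h < c \<Longrightarrow> g t < g (t - h)"
    using has_real_derivative_neg_dec_left[OF g] by auto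
  define h where "h = min (min c e) (t - t0) / 2"
  have "0 < h" "h < c" "h < e" "h < t - t0"
    using c assms by (auto simp: h_def min_def field_simps)
  then show False
    using c(2)[of h] max[of "t - h"] assms(2-5) by force
qed

lemma deriv_nonpos_of_left_min:
  fixes g :: "real \<Rightarrow> real"
  assumes g: "(g has_real_derivative d) (at t within {0..<T})"
    and "0 \<le> t0" "t0 < t" "t < T" "e > 0"
    and min: "\<And>s. t0 \<le> s \<Longrightarrow> s \<le> t \<Longrightarrow> t - e < s \<Longrightarrow> g t \<le> g s"
  shows "d \<le> 0"
  using deriv_nonneg_of_left_max[OF DERIV_minus[OF g], of t0 e] assms by auto

section \<open>Comparison arguments for a radial flow\<close>

text \<open>The data that the comparison arguments consume, with \<open>p\<close> and
  \<open>q\<close> the first two space derivatives of \<open>w\<close>. The support hypersurface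
  enters only through the sign of \<open>p\<close> at the contact circle. The evolution equation is
  available strictly between axis and boundary, so extrema at either end must be excluded by
  first-order arguments.\<close>

locale radial_flow =
  fixes N T :: real and r :: "real \<Rightarrow> real" and w p q :: "real \<Rightarrow> real \<Rightarrow> real"
  assumes N: "N > 1"
    and r_pos: "\<And>t. 0 \<le> t \<Longrightarrow> t < T \<Longrightarrow> 0 < r t"
    and r_cont: "continuous_on {0..<T} r"
    and w_cont: "continuous_on {(y, t). 0 \<le> y \<and> y \<le> r t \<and> 0 \<le> t \<and> t < T} (\<lambda>(y, t). w y t)"
    and w_deriv: "\<And>y t. 0 \<le> t \<Longrightarrow> t < T \<Longrightarrow> 0 < y \<Longrightarrow> y < r t \<Longrightarrow>
          ((\<lambda>\<eta>. w \<eta> t) has_real_derivative p y t) (at y)"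
    and p_deriv: "\<And>y t. 0 \<le> t \<Longrightarrow> t < T \<Longrightarrow> 0 < y \<Longrightarrow> y < r t \<Longrightarrow>
          ((\<lambda>\<eta>. p \<eta> t) has_real_derivative q y t) (at y)"
    and evolution: "\<And>y t. 0 \<le> t \<Longrightarrow> t < T \<Longrightarrow> 0 < y \<Longrightarrow> y < r t \<Longrightarrow>
          ((\<lambda>s. w y s) has_real_derivative q y t / (1 + (p y t)\<^sup>2) + (N - 1) / y * p y t)
            (at t within {0..<T})"
    and w_deriv_bdry: "\<And>t. 0 \<le> t \<Longrightarrow> t < T \<Longrightarrow>
          ((\<lambda>\<eta>. w \<eta> t) has_real_derivative p (r t) t) (at (r t) within {0<..r t})"
    and p_cont: "\<And>t. 0 \<le> t \<Longrightarrow> t < T \<Longrightarrow> continuous_on {0<..r t} (\<lambda>y. p y t)"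
    and p_axis: "\<And>t. 0 \<le> t \<Longrightarrow> t < T \<Longrightarrow> ((\<lambda>y. p y t) \<longlongrightarrow> 0) (at_right 0)"
    and p_bdry: "\<And>t. 0 \<le> t \<Longrightarrow> t < T \<Longrightarrow> p (r t) t < 0"
begin

lemma continuous_on_w:
  assumes "continuous_on A f" "continuous_on A g"
    and "\<And>a. a \<in> A \<Longrightarrow> 0 \<le> f a \<and> f a \<le> r (g a) \<and> 0 \<le> g a \<and> g a < T"
  shows "continuous_on A (\<lambda>a. w (f a) (g a))"
  using continuous_on_compose2[OF w_cont continuous_on_Pair[OF assms(1,2)]] assms(3) by auto

text \<open>Makes comparison at a fixed radius legitimate for times shortly before \<open>t\<close>,
  although the domain moves.\<close>

lemma radius_stays_above:
  assumes "0 < t" "t < T" "b < r t"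
  obtains e where "e > 0" "\<And>s. s \<in> {0..<T} \<Longrightarrow> \<bar>s - t\<bar> < e \<Longrightarrow> b < r s"
proof -
  have "isCont r t"
    using r_cont assms
    by (metis continuous_on_interior interior_atLeastLessThan greaterThanLessThan_iff)
  then have "\<forall>\<^sub>F s in at t. b < r s"
    using assms(3) by (auto simp: isCont_def order_tendstoD)
  then obtain e where "e > 0" "\<And>s. s \<noteq> t \<Longrightarrow> dist s t < e \<Longrightarrow> b < r s"
    unfolding eventually_at by auto
  then show thesis using that[of e] assms(3) by (metis dist_real_def)
qed

lemma mean_value:
  assumes "0 \<le> t" "t < T" "0 \<le> a" "a < b" "b \<le> r t"
  obtains y where "a < y" "y < b" "w b t - w a t = p y t * (b - a)"
proof -
  have "continuous_on {a..b} (\<lambda>y. w y t)"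
    by (rule continuous_on_w) (use assms in auto)
  moreover have "((\<lambda>y. w y t) has_derivative (\<lambda>h. p y t * h)) (at y)" if "a < y" "y < b" for y
    using w_deriv[of t y] that assms by (simp add: has_field_derivative_def)
  ultimately obtain y where "a < y" "y < b" "w b t - w a t = p y t * (b - a)"
    by (rule mvt[OF \<open>a < b\<close>, of "\<lambda>y. w y t" "\<lambda>y h. p y t * h"])
  then show thesis by (rule that)
qed

text \<open>The slope tends to 0 at the axis, so the mean value theorem makes increments from the
  axis small to first order. Both comparison arguments use this to exclude an extremum on the
  axis.\<close>

lemma axis_increment:
  assumes "0 \<le> t" "t < T" "\<epsilon> > 0"
  obtains d where "d > 0" "\<And>y. 0 < y \<Longrightarrow> y < d \<Longrightarrow> y \<le> r t \<Longrightarrow> w y t - w 0 t < \<epsilon> * y"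
proof -
  have "\<forall>\<^sub>F y in at_right 0. p y t < \<epsilon>"
    using order_tendstoD(2)[OF p_axis] assms by auto
  then obtain d where d: "d > 0" "\<And>y. 0 < y \<Longrightarrow> y < d \<Longrightarrow> p y t < \<epsilon>"
    unfolding eventually_at_right_field by auto
  have "w y t - w 0 t < \<epsilon> * y" if "0 < y" "y < d" "y \<le> r t" for y
  proof -
    obtain u where "0 < u" "u < y" "w y t - w 0 t = p u t * (y - 0)"
      using mean_value[of t 0 y] assms \<open>0 < y\<close> \<open>y \<le> r t\<close> by auto
    then show ?thesis using d(2)[of u] that by auto
  qed
  then show thesis using d(1) that by blast
qed

text \<open>Near the axis the slope is below 1; on the rest it is bounded by compactness. Stating
  the bound through increments gives the form that is propagated in time.\<close>

lemma slope_bound_at: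
  assumes "0 \<le> t" "t < T"
  obtains C where "C > 0" "\<And>a b. 0 \<le> a \<Longrightarrow> a \<le> b \<Longrightarrow> b \<le> r t \<Longrightarrow> w b t - w a t \<le> C * (b - a)"
proof -
  have "\<forall>\<^sub>F y in at_right 0. p y t < 1"
    using order_tendstoD(2)[OF p_axis] assms by auto
  then obtain d where d: "d > 0" "\<And>y. 0 < y \<Longrightarrow> y < d \<Longrightarrow> p y t < 1"
    unfolding eventually_at_right_field by auto
  have "compact ((\<lambda>y. p y t) ` {d..r t})"
    by (rule compact_continuous_image)
      (use d assms in \<open>auto intro: continuous_on_subset[OF p_cont]\<close>)
  then obtain B where B: "\<And>y. d \<le> y \<Longrightarrow> y \<le> r t \<Longrightarrow> \<bar>p y t\<bar> \<le> B"
    using compact_imp_bounded bounded_real by (metis atLeastAtMost_iff imageI)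
  have le: "p y t \<le> max 1 B" if "0 < y" "y \<le> r t" for y
    using d(2)[of y] B[of y] that by (cases "y < d") auto
  have "w b t - w a t \<le> max 1 B * (b - a)" if ab: "0 \<le> a" "a \<le> b" "b \<le> r t" for a b
  proof (cases "a = b")
    case False
    then obtain y where "a < y" "y < b" "w b t - w a t = p y t * (b - a)"
      using ab assms by (auto intro: mean_value[of t a b])
    then show ?thesis using le[of y] ab by (auto intro: mult_right_mono)
  qed auto
  then show thesis using that[of "max 1 B"] by auto
qed

text \<open>Differentiating the equation would cost a third derivative; comparing two points avoids
  this. At an interior maximum of \<open>G\<close> both slopes equal \<open>C\<close>, while
  \<open>q\<close> is nonpositive at \<open>b\<close> and nonnegative at \<open>a\<close>. Since
  \<open>a < b\<close> and \<open>C > 0\<close>, the term with \<open>1 / y\<close> is also ordered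
  favourably, so \<open>G\<close> would have to decrease in time at rate at least
  \<open>\<eta>\<close>.\<close>

lemma slope_bound_preserved:
  assumes "C > 0" and t1: "0 < t1" "t1 < T"
    and init: "\<And>a b. 0 \<le> a \<Longrightarrow> a \<le> b \<Longrightarrow> b \<le> r 0 \<Longrightarrow> w b 0 - w a 0 \<le> C * (b - a)"
    and ab: "0 \<le> a1" "a1 \<le> b1" "b1 \<le> r t1"
  shows "w b1 t1 - w a1 t1 \<le> C * (b1 - a1)"
proof (rule ccontr)
  assume neg: "\<not> ?thesis"
  \<comment> \<open>With this choice the penalty \<open>\<eta> * t\<close> consumes exactly half of
    the supposed excess at time \<open>t1\<close>, so \<open>G\<close> is still positive
    there.\<close>
  define \<eta> where "\<eta> = (w b1 t1 - w a1 t1 - C * (b1 - a1)) / (2 * t1)"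
  have \<eta>: "\<eta> > 0" "w b1 t1 - w a1 t1 - C * (b1 - a1) - \<eta> * t1 > 0"
    using neg t1 by (auto simp: \<eta>_def zero_less_divide_iff)
  define G where "G t a b = w b t - w a t - C * (b - a) - \<eta> * t" for t a b
  \<comment> \<open>The moving region \<open>0 \<le> a \<le> b \<le> r t\<close> is parametrised
    over a fixed compact box by \<open>b = v * r t\<close> and \<open>a = u * b\<close>, so that a
    maximum exists.\<close>
  let ?B = "{0..t1} \<times> {0..1::real} \<times> {0..1::real}"
  let ?g = "\<lambda>(t, u, v). G t (u * (v * r t)) (v * r t)"
  have rc: "continuous_on ?B (\<lambda>x. r (fst x))"
    by (rule continuous_on_compose2[OF r_cont]) (use t1 in \<open>auto intro!: continuous_intros\<close>)
  have rp: "0 < r t" if "0 \<le> t" "t \<le> t1" for t using r_pos that t1 by auto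
  have range_b: "0 \<le> v * r t" "v * r t \<le> r t" if "0 \<le> t" "t \<le> t1" "0 \<le> v" "v \<le> 1" for t v
    using rp[of t] that by (auto simp: mult_left_le_one_le)
  have range_a: "0 \<le> u * (v * r t)" "u * (v * r t) \<le> r t"
    if "0 \<le> t" "t \<le> t1" "0 \<le> u" "u \<le> 1" "0 \<le> v" "v \<le> 1" for t u v
    using range_b[of t v] that mult_left_le_one_le[of "v * r t" u] by auto
  have cont_b: "continuous_on ?B (\<lambda>x. snd (snd x) * r (fst x))"
    by (intro continuous_intros rc)
  have cont_a: "continuous_on ?B (\<lambda>x. fst (snd x) * (snd (snd x) * r (fst x)))"
    by (intro continuous_intros rc)
  have cont_t: "continuous_on ?B (\<lambda>x. fst x)"
    by (intro continuous_intros)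
  have "continuous_on ?B (\<lambda>x. w (snd (snd x) * r (fst x)) (fst x))"
    by (rule continuous_on_w[OF cont_b cont_t]) (use t1 range_b in auto)
  moreover have "continuous_on ?B (\<lambda>x. w (fst (snd x) * (snd (snd x) * r (fst x))) (fst x))"
    by (rule continuous_on_w[OF cont_a cont_t]) (use t1 range_a in auto)
  ultimately have cont: "continuous_on ?B ?g"
    unfolding G_def case_prod_unfold
    by (intro continuous_on_diff continuous_on_mult continuous_on_const cont_a cont_b cont_t)
  have "compact ?B" "?B \<noteq> {}"
    using t1 by (auto intro!: compact_Times)
  then obtain x where x: "x \<in> ?B" "\<And>x'. x' \<in> ?B \<Longrightarrow> ?g x' \<le> ?g x"
    using continuous_attains_sup[OF _ _ cont] by blast
  obtain t u v where tuv: "x = (t, u, v)" by (cases x)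
  define a where "a = u * (v * r t)"
  define b where "b = v * r t"
  have t: "0 \<le> t" "t \<le> t1" and uv: "0 \<le> u" "u \<le> 1" "0 \<le> v" "v \<le> 1"
    using x(1) tuv by auto
  have rt: "0 < r t" using rp t by auto
  have abt: "0 \<le> a" "a \<le> b" "b \<le> r t"
    using uv rt by (auto simp: a_def b_def mult_left_le_one_le)
  have Gmax: "G s a' b' \<le> G t a b"
    if s: "0 \<le> s" "s \<le> t1" "0 \<le> a'" "a' \<le> b'" "b' \<le> r s" for s a' b'
  proof -
    have "r s > 0" using rp s by auto
    then have "(s, (if b' = 0 then 0 else a' / b'), b' / r s) \<in> ?B"
      using s by auto
    from x(2)[OF this] show ?thesis
      using s \<open>r s > 0\<close> by (auto simp: tuv a_def b_def split: if_splits)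
  qed
  have Gpos: "G t a b > 0"
    using Gmax[of t1 a1 b1] ab \<eta>(2) t1 by (auto simp: G_def)
  have t0: "t > 0"
    using Gpos init[of a b] abt t by (cases "t = 0") (auto simp: G_def)
  have lt: "a < b"
  proof -
    have "0 \<le> \<eta> * t" using \<eta>(1) t by simp
    then have "a \<noteq> b" using Gpos by (auto simp: G_def)
    then show ?thesis using abt by simp
  qed
  have tT: "t < T" using t t1 by auto
  \<comment> \<open>On the axis the slope is 0, below \<open>C\<close>, so moving \<open>a\<close>
    off the axis would increase \<open>G\<close>.\<close>
  have a0: "a > 0"
  proof (rule ccontr)
    assume "\<not> a > 0"
    then have "a = 0" using abt by auto
    obtain d where d: "d > 0" "\<And>y. 0 < y \<Longrightarrow> y < d \<Longrightarrow> y \<le> r t \<Longrightarrow> w y t - w 0 t < C * y"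
      using axis_increment[of t C] t tT \<open>C > 0\<close> by auto
    define h where "h = min d b / 2"
    have h: "0 < h" "h < d" "h < b"
      using d lt \<open>a = 0\<close> by (auto simp: h_def min_def)
    have "w h t - w 0 t < C * h"
      using d(2) h abt by auto
    moreover have "G t h b \<le> G t 0 b"
      using Gmax[of t h b] h abt t \<open>a = 0\<close> by auto
    ultimately show False by (auto simp: G_def algebra_simps)
  qed
  \<comment> \<open>At the contact circle the slope is negative, hence below \<open>C\<close>, so
    moving \<open>b\<close> inwards would increase \<open>G\<close>.\<close>
  have br: "b < r t"
  proof (rule ccontr)
    assume "\<not> b < r t"
    then have b: "b = r t" using abt by auto
    have "((\<lambda>y. w y t - C * y) has_real_derivative p (r t) t - C) (at (r t) within {0<..r t})"
      by (auto intro!: derivative_eq_intros w_deriv_bdry t tT)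
    moreover have "p (r t) t - C < 0"
      using p_bdry[of t] t tT \<open>C > 0\<close> by auto
    ultimately obtain d where d: "d > 0" "\<And>h. 0 < h \<Longrightarrow> r t - h \<in> {0<..r t} \<Longrightarrow> h < d \<Longrightarrow>
        w (r t) t - C * r t < w (r t - h) t - C * (r t - h)"
      using has_real_derivative_neg_dec_left by blast
    define h where "h = min d (b - a) / 2"
    have h: "0 < h" "h < d" "h < b - a"
      using d lt by (auto simp: h_def min_def field_simps)
    have "G t a (b - h) \<le> G t a b"
      using Gmax[of t a "b - h"] h abt t by auto
    moreover have "w (r t) t - C * r t < w (r t - h) t - C * (r t - h)"
      using d(2)[of h] h b abt by auto
    ultimately show False using b by (auto simp: G_def algebra_simps)
  qed
  \<comment> \<open>At a fixed time \<open>G\<close> is, up to a constant, the difference of the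
    values of this tilted function at \<open>b\<close> and at \<open>a\<close>. So \<open>b\<close>
    maximises it over \<open>(a, r t)\<close> and \<open>a\<close> minimises it over
    \<open>(0, b)\<close>.\<close>
  have tilt_deriv: "((\<lambda>y. w y t - C * y) has_real_derivative p y t - C) (at y)"
    if "0 < y" "y < r t" for y
    using that t tT by (auto intro!: derivative_eq_intros w_deriv)
  have "((\<lambda>y. p y t - C) has_real_derivative q b t) (at b)"
    using a0 lt br t tT by (auto intro!: derivative_eq_intros p_deriv)
  moreover have "w y t - C * y \<le> w b t - C * b" if "a < y" "y < r t" for y
    using Gmax[of t a y] that a0 t by (auto simp: G_def algebra_simps)
  ultimately have b_max: "p b t - C = 0" "q b t \<le> 0"
    using local_max_second_deriv_nonpos[of a b "r t" "\<lambda>y. w y t - C * y" "\<lambda>y. p y t - C" "q b t"]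
      tilt_deriv lt br a0 by auto
  have "((\<lambda>y. p y t - C) has_real_derivative q a t) (at a)"
    using a0 lt br t tT by (auto intro!: derivative_eq_intros p_deriv)
  moreover have "w a t - C * a \<le> w y t - C * y" if "0 < y" "y < b" for y
    using Gmax[of t y b] that a0 t br by (auto simp: G_def algebra_simps)
  ultimately have a_min: "p a t - C = 0" "q a t \<ge> 0"
    using local_min_second_deriv_nonneg[of 0 a b "\<lambda>y. w y t - C * y" "\<lambda>y. p y t - C" "q a t"]
      tilt_deriv lt br a0 by auto
  define L where "L y = q y t / (1 + (p y t)\<^sup>2) + (N - 1) / y * p y t" for y
  have G_deriv: "((\<lambda>s. G s a b) has_real_derivative L b - L a - \<eta>) (at t within {0..<T})"
    unfolding G_def L_def
    using a0 lt br t tT by (auto intro!: derivative_eq_intros evolution)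
  obtain e where e: "e > 0" "\<And>s. s \<in> {0..<T} \<Longrightarrow> \<bar>s - t\<bar> < e \<Longrightarrow> b < r s"
    by (rule radius_stays_above[of t b]) (use t0 tT br in auto)
  have "G s a b \<le> G t a b" if "0 \<le> s" "s \<le> t" "t - e < s" for s
    using Gmax[of s a b] e(2)[of s] that abt t tT by simp
  then have "0 \<le> L b - L a - \<eta>"
    using deriv_nonneg_of_left_max[OF G_deriv, of 0 e] t0 tT e(1) by simp
  moreover have "L b \<le> L a"
  proof -
    have "q b t / (1 + C\<^sup>2) \<le> q a t / (1 + C\<^sup>2)"
      by (rule divide_right_mono) (use a_min b_max in auto)
    moreover have "(N - 1) / b \<le> (N - 1) / a"
      by (rule divide_left_mono) (use lt a0 N in auto)
    then have "(N - 1) / b * C \<le> (N - 1) / a * C"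
      using \<open>C > 0\<close> by (intro mult_right_mono) auto
    moreover have "p a t = C" "p b t = C"
      using a_min b_max by auto
    ultimately show ?thesis
      unfolding L_def by (simp only: add_mono)
  qed
  ultimately show False using \<eta> by auto
qed

text \<open>The sinking paraboloid is a subsolution: with slope \<open>- K * y\<close> and second
  derivative \<open>- K\<close>, the right-hand side of the equation is at least
  \<open>- N * K\<close>, its speed. At the boundary its slope is \<open>- K * r t\<close>, whereas
  \<open>w\<close> may descend only half as steeply; the other half is room for a
  perturbation.\<close>

lemma height_lower_bound:
  assumes t02: "0 \<le> t0" "t2 < T" and "K > 0"
    and bdry: "\<And>t. t0 \<le> t \<Longrightarrow> t \<le> t2 \<Longrightarrow> - p (r t) t \<le> K / 2 * r t"
    and init: "\<And>y. 0 \<le> y \<Longrightarrow> y \<le> r t0 \<Longrightarrow> m \<le> w y t0"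
    and t1: "t0 \<le> t1" "t1 \<le> t2" and y1: "0 \<le> y1" "y1 \<le> r t1"
  shows "m - N * K * (t1 - t0) - K / 2 * y1\<^sup>2 \<le> w y1 t1"
proof (rule ccontr)
  assume neg: "\<not> ?thesis"
  define X where "X = w y1 t1 - (m - N * K * (t1 - t0) - K / 2 * y1\<^sup>2)"
  have "X < 0" using neg by (auto simp: X_def)
  have rp: "0 < r t" if "t0 \<le> t" "t \<le> t2" for t using r_pos that t02 by auto
  have "continuous_on {t0..t2} r"
    by (rule continuous_on_subset[OF r_cont]) (use t02 in auto)
  then obtain tm where tm: "t0 \<le> tm" "tm \<le> t2" "\<And>t. t0 \<le> t \<Longrightarrow> t \<le> t2 \<Longrightarrow> r tm \<le> r t"
    using continuous_attains_inf[of "{t0..t2}" r] t1 by force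
  \<comment> \<open>The first bound keeps \<open>\<epsilon>\<close> below the boundary slack
    \<open>K / 2 * r t\<close> at all times, which is why the minimal radius \<open>r tm\<close>
    appears. The second keeps \<open>H\<close> above \<open>X\<close> at the initial time.\<close>
  define \<epsilon> where "\<epsilon> = min (K * r tm / 4) (- X / (2 * r t0))"
  have rt0: "r t0 > 0" using rp t1 by auto
  have \<epsilon>: "\<epsilon> > 0" using rt0 rp[OF tm(1,2)] \<open>X < 0\<close> \<open>K > 0\<close> by (auto simp: \<epsilon>_def divide_less_0_iff)
  have "\<epsilon> * r t0 \<le> - X / (2 * r t0) * r t0"
    using rt0 by (intro mult_right_mono) (auto simp: \<epsilon>_def)
  then have \<epsilon>X: "\<epsilon> * r t0 < - X" using rt0 \<open>X < 0\<close> by auto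
  have \<epsilon>K: "\<epsilon> < K / 2 * r t" if "t0 \<le> t" "t \<le> t2" for t
  proof -
    have "\<epsilon> \<le> K / 4 * r tm" by (auto simp: \<epsilon>_def)
    also have "\<dots> < K / 2 * r tm" using rp[OF tm(1,2)] \<open>K > 0\<close> by auto
    also have "\<dots> \<le> K / 2 * r t" using tm(3)[OF that] \<open>K > 0\<close> by auto
    finally show ?thesis .
  qed
  (* The kink - eps y keeps the minimum of H away from the axis, where no evolution equation is
     available, and makes the comparison strict in the interior. *)
  define H where "H t y = w y t - m + N * K * (t - t0) + K / 2 * y\<^sup>2 - \<epsilon> * y" for t y
  let ?B = "{t0..t2} \<times> {0..1::real}"
  let ?g = "\<lambda>(t, v). H t (v * r t)"
  have rc: "continuous_on ?B (\<lambda>x. r (fst x))"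
    by (rule continuous_on_compose2[OF r_cont]) (use t02 in \<open>auto intro!: continuous_intros\<close>)
  have cont_y: "continuous_on ?B (\<lambda>x. snd x * r (fst x))"
    by (intro continuous_intros rc)
  have cont_t: "continuous_on ?B (\<lambda>x. fst x)"
    by (intro continuous_intros)
  have "0 \<le> v * r t \<and> v * r t \<le> r t" if "t0 \<le> t" "t \<le> t2" "0 \<le> v" "v \<le> 1" for t v
    using rp[of t] that by (auto simp: mult_left_le_one_le)
  then have "continuous_on ?B (\<lambda>x. w (snd x * r (fst x)) (fst x))"
    by (intro continuous_on_w[OF cont_y cont_t]) (use t02 in auto)
  then have cont: "continuous_on ?B ?g"
    unfolding H_def case_prod_unfold
    by (intro continuous_on_diff continuous_on_add continuous_on_mult continuous_on_power
        continuous_on_const cont_y cont_t)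
  have "compact ?B" "?B \<noteq> {}"
    using t1 by (auto intro!: compact_Times)
  then obtain x where x: "x \<in> ?B" "\<And>x'. x' \<in> ?B \<Longrightarrow> ?g x \<le> ?g x'"
    using continuous_attains_inf[OF _ _ cont] by blast
  obtain t v where tv: "x = (t, v)" by (cases x)
  define y where "y = v * r t"
  have t: "t0 \<le> t" "t \<le> t2" and v: "0 \<le> v" "v \<le> 1"
    using x(1) tv by auto
  have tT: "0 \<le> t" "t < T" using t t02 by auto
  have rt: "0 < r t" using rp t by auto
  have yt: "0 \<le> y" "y \<le> r t"
    using v rt by (auto simp: y_def mult_left_le_one_le)
  have Hmin: "H t y \<le> H s y'"
    if s: "t0 \<le> s" "s \<le> t2" "0 \<le> y'" "y' \<le> r s" for s y'
  proof -
    have "r s > 0" using rp s by auto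
    then have "(s, y' / r s) \<in> ?B" using s by auto
    from x(2)[OF this] show ?thesis
      using \<open>r s > 0\<close> by (auto simp: tv y_def)
  qed
  have "H t y \<le> X - \<epsilon> * y1"
    using Hmin[OF t1 y1] by (simp add: H_def X_def)
  moreover have "0 \<le> \<epsilon> * y1"
    using y1 \<epsilon> by simp
  ultimately have "H t y \<le> X" by linarith
  have t0t: "t0 < t"
  proof (rule ccontr)
    assume "\<not> t0 < t"
    then have [simp]: "t = t0" using t by auto
    have "\<epsilon> * y \<le> \<epsilon> * r t0" using yt \<epsilon> by auto
    moreover have "0 \<le> K / 2 * y\<^sup>2"
      using \<open>K > 0\<close> by simp
    then have "H t y \<ge> - \<epsilon> * y"
      using init[of y] yt by (simp add: H_def)
    ultimately show False using \<open>H t y \<le> X\<close> \<epsilon>X by auto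
  qed
  have y0: "y > 0"
  proof (rule ccontr)
    assume "\<not> y > 0"
    then have "y = 0" using yt by auto
    obtain d where d: "d > 0" "\<And>y. 0 < y \<Longrightarrow> y < d \<Longrightarrow> y \<le> r t \<Longrightarrow> w y t - w 0 t < \<epsilon> / 2 * y"
      using axis_increment[of t "\<epsilon> / 2"] tT \<epsilon> by auto
    \<comment> \<open>For \<open>h \<le> \<epsilon> / K\<close> the quadratic term is at most
      \<open>\<epsilon> * h / 2\<close>; together with an increment of \<open>w\<close> below
      \<open>\<epsilon> * h / 2\<close> this is beaten by the kink, so
      \<open>H t h < H t 0\<close>.\<close>
    have "0 < min (min d (r t)) (\<epsilon> / K)"
      using \<epsilon> \<open>K > 0\<close> d(1) rt by simp
    then obtain h where "0 < h" "h < min (min d (r t)) (\<epsilon> / K)"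
      using dense by blast
    then have h: "0 < h" "h < d" "h < r t" "h \<le> \<epsilon> / K"
      by auto
    then have "K * h \<le> \<epsilon>"
      using \<open>K > 0\<close> by (simp add: field_simps)
    have "w h t - w 0 t < \<epsilon> / 2 * h"
      using d(2) h by auto
    moreover have "H t 0 \<le> H t h"
      using Hmin[of t h] h t \<open>y = 0\<close> by auto
    moreover have "(K * h) * h \<le> \<epsilon> * h"
      using h(1) \<open>K * h \<le> \<epsilon>\<close> by (intro mult_right_mono) auto
    ultimately show False by (auto simp: H_def power2_eq_square algebra_simps)
  qed
  have H_deriv: "(H t has_real_derivative p y t + K * y - \<epsilon>) (at y)" if "0 < y" "y < r t" for y
    unfolding H_def using that tT by (auto intro!: derivative_eq_intros w_deriv)
  have yr: "y < r t"
  proof (rule ccontr)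
    assume "\<not> y < r t"
    then have y: "y = r t" using yt by auto
    have "(H t has_real_derivative p (r t) t + K * r t - \<epsilon>) (at (r t) within {0<..r t})"
      unfolding H_def by (auto intro!: derivative_eq_intros w_deriv_bdry tT)
    moreover have "p (r t) t + K * r t - \<epsilon> > 0"
      using bdry[OF t] \<epsilon>K[OF t] by auto
    ultimately obtain d where d: "d > 0" "\<And>h. 0 < h \<Longrightarrow> r t - h \<in> {0<..r t} \<Longrightarrow> h < d \<Longrightarrow>
        H t (r t - h) < H t (r t)"
      using has_real_derivative_pos_inc_left by blast
    define h where "h = min d (r t) / 2"
    have h: "0 < h" "h < d" "h < r t"
      using d rt by (auto simp: h_def min_def field_simps)
    show False
      using Hmin[of t "r t - h"] d(2)[of h] h t y by auto
  qed
  have "((\<lambda>y. p y t + K * y - \<epsilon>) has_real_derivative q y t + K) (at y)"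
    using y0 yr tT by (auto intro!: derivative_eq_intros p_deriv)
  then have y_min: "p y t + K * y - \<epsilon> = 0" "q y t + K \<ge> 0"
    using local_min_second_deriv_nonneg[of 0 y "r t" "H t" "\<lambda>y. p y t + K * y - \<epsilon>" "q y t + K"]
      H_deriv Hmin[of t] y0 yr t by auto
  have H_time_deriv: "((\<lambda>s. H s y) has_real_derivative
      q y t / (1 + (p y t)\<^sup>2) + (N - 1) / y * p y t + N * K) (at t within {0..<T})"
    unfolding H_def using y0 yr tT by (auto intro!: derivative_eq_intros evolution)
  obtain e where e: "e > 0" "\<And>s. s \<in> {0..<T} \<Longrightarrow> \<bar>s - t\<bar> < e \<Longrightarrow> y < r s"
    by (rule radius_stays_above[of t y]) (use t0t t02 tT yr in auto)
  have "H t y \<le> H s y" if "t0 \<le> s" "s \<le> t" "t - e < s" for s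
    using Hmin[of s y] e(2)[of s] that yt t tT t02 by simp
  then have "q y t / (1 + (p y t)\<^sup>2) + (N - 1) / y * p y t + N * K \<le> 0"
    using deriv_nonpos_of_left_min[OF H_time_deriv, of t0 e] t0t t02 tT e(1) by simp
  \<comment> \<open>All multiples of \<open>K\<close> cancel in the time derivative of
    \<open>H\<close>; what remains is at least \<open>(N - 1) * \<epsilon> / y\<close>, which is
    positive.\<close>
  moreover have "q y t / (1 + (p y t)\<^sup>2) \<ge> - K"
  proof -
    have "K / (1 + (p y t)\<^sup>2) \<le> K / 1"
      using \<open>K > 0\<close> by (intro divide_left_mono) (auto simp: add_pos_nonneg)
    then have "- K \<le> - K / (1 + (p y t)\<^sup>2)"
      by simp
    also have "\<dots> \<le> q y t / (1 + (p y t)\<^sup>2)"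
      using y_min by (intro divide_right_mono) auto
    finally show ?thesis .
  qed
  moreover have "(N - 1) / y * p y t = (N - 1) * \<epsilon> / y - (N - 1) * K"
  proof -
    have "p y t = \<epsilon> - K * y" using y_min by auto
    then show ?thesis using y0 by (auto simp: field_simps)
  qed
  moreover have "(N - 1) * \<epsilon> / y > 0"
    using N \<epsilon> y0 by auto
  ultimately show False by (auto simp: algebra_simps)
qed

section \<open>Decay rate of the contact height\<close>

text \<open>The condition \<open>\<delta> > 1\<close> makes the radius negligible against the
  height, so the slope bound lifts the whole graph. The condition
  \<open>2 * \<delta> > \<alpha> + 1\<close> makes the quadratic term of the barrier negligible at
  the contact circle.\<close>

lemma height_rate:
  fixes \<alpha> \<delta> C2 D t1 :: real
  defines "z \<equiv> \<lambda>t. w (r t) t"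
  assumes t1: "0 \<le> t1" "t1 < T"
    and z_pos: "\<And>t. t1 \<le> t \<Longrightarrow> t < T \<Longrightarrow> 0 < z t"
    and z_lim: "(z \<longlongrightarrow> 0) (at_left T)"
    and C2: "C2 > 0" and D: "D > 0" and exps: "\<alpha> > 0" "\<delta> > 1" "2 * \<delta> > \<alpha> + 1"
    and slope: "\<And>t. t1 \<le> t \<Longrightarrow> t < T \<Longrightarrow> - p (r t) t \<le> C2 / z t powr \<alpha> * r t"
    and radius: "\<And>t. t1 \<le> t \<Longrightarrow> t < T \<Longrightarrow> r t \<le> D * z t powr \<delta>"
  shows "\<exists>C>0. \<forall>\<^sub>F t in at_left T. z t powr (\<alpha> + 1) \<le> C * (T - t)"
proof -
  obtain C where C: "C > 0" "\<And>a b. 0 \<le> a \<Longrightarrow> a \<le> b \<Longrightarrow> b \<le> r 0 \<Longrightarrow> w b 0 - w a 0 \<le> C * (b - a)"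
    using slope_bound_at[of 0] t1 by auto
  have z_cont: "continuous_on {0..<T} z"
    unfolding z_def by (rule continuous_on_w[OF r_cont continuous_on_id]) (use r_pos in \<open>auto intro: less_imp_le\<close>)
  have ev: "\<forall>\<^sub>F t in at_left T. t1 < t \<and> t < T"
    using t1 eventually_at_left_field by blast
  have z_right: "filterlim z (at_right 0) (at_left T)"
    unfolding filterlim_at using z_lim
    by (auto intro!: eventually_mono[OF ev] dest!: z_pos[OF less_imp_le])
  have pw: "((\<lambda>x. c * x powr s) \<longlongrightarrow> 0) (at_right 0)" if "s > 0" for c s :: real
  proof (intro tendsto_mult_right_zero tendsto_zero_powrI)
    show "\<forall>\<^sub>F x in at_right 0. 0 \<le> (x::real)"
      using eventually_at_right_less by (rule eventually_mono) simp
  qed (use that in \<open>auto intro: tendsto_eq_intros\<close>)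
  \<comment> \<open>With the radius bound, this smallness gives
    \<open>C * r t0 \<le> z0 / 2\<close>, and the next one, whose powers of 1/8 come from evaluating
    at \<open>z0 / 8\<close>, gives \<open>K / 2 * (r t2)\<^sup>2 \<le> z0 / 8\<close>.\<close>
  have "\<forall>\<^sub>F x in at_right 0. C * D * x powr (\<delta> - 1) < 1 / 2"
    by (rule order_tendstoD(2)[OF pw]) (use exps in auto)
  moreover have "\<forall>\<^sub>F x in at_right 0. C2 * D\<^sup>2 * (1 / 8) powr (2 * \<delta> - \<alpha> - 1) * x powr (2 * \<delta> - \<alpha> - 1) < 1"
    by (rule order_tendstoD(2)[OF pw]) (use exps in auto)
  ultimately have "\<forall>\<^sub>F x in at_right 0. C * D * x powr (\<delta> - 1) < 1 / 2 \<and>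
      C2 * D\<^sup>2 * (1 / 8) powr (2 * \<delta> - \<alpha> - 1) * x powr (2 * \<delta> - \<alpha> - 1) < 1"
    by eventually_elim simp
  from eventually_compose_filterlim[OF this z_right] ev
  have "\<forall>\<^sub>F t in at_left T. z t powr (\<alpha> + 1) \<le> 8 * N * C2 * 8 powr \<alpha> * (T - t)"
  proof eventually_elim
    case (elim t0)
    define z0 where "z0 = z t0"
    \<comment> \<open>The barrier starts at \<open>z0 / 2 = 4 * x\<close>. One \<open>x\<close> is
      lost to the quadratic term and one is the final height, so \<open>2 * x\<close> remains to be
      covered by the sinking of the barrier.\<close>
    define x where "x = z0 / 8"
    have t0: "0 \<le> t0" "t1 \<le> t0" "t0 < T" "0 < t0" using elim t1 by auto
    have z0: "z0 > 0" using z_pos t0 by (auto simp: z0_def)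
    then have x0: "x > 0" by (simp add: x_def)
    have Cr: "C * r t0 \<le> z0 / 2"
    proof -
      have "C * r t0 \<le> C * (D * z0 powr \<delta>)"
        using radius[of t0] t0 C by (auto simp: z0_def)
      also have "\<dots> = (C * D * z0 powr (\<delta> - 1)) * z0"
        using powr_add[of z0 "\<delta> - 1" 1] z0 by simp
      also have "\<dots> \<le> 1 / 2 * z0"
        using elim z0 by (intro mult_right_mono) (auto simp: z0_def)
      finally show ?thesis by simp
    qed
    have init: "z0 / 2 \<le> w y t0" if "0 \<le> y" "y \<le> r t0" for y
    proof -
      have "w (r t0) t0 - w y t0 \<le> C * (r t0 - y)"
        by (rule slope_bound_preserved[OF C(1) t0(4,3) C(2)]) (use that in auto)
      also have "\<dots> \<le> C * r t0" using C that by (auto intro!: mult_left_mono)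
      finally show ?thesis using Cr by (auto simp: z0_def z_def)
    qed
    obtain t' where t': "t0 < t'" "t' < T" "z t' < x"
    proof -
      have "\<forall>\<^sub>F t in at_left T. z t < x"
        using order_tendstoD(2)[OF z_lim x0] .
      moreover have "\<forall>\<^sub>F t in at_left T. t0 < t \<and> t < T"
        using t0 eventually_at_left_field by blast
      ultimately have "\<forall>\<^sub>F t in at_left T. t0 < t \<and> t < T \<and> z t < x"
        by eventually_elim auto
      then show thesis using that eventually_happens trivial_limit_at_left_real by blast
    qed
    have zc: "continuous_on {t0..b} z" if "b < T" for b
      by (rule continuous_on_subset[OF z_cont]) (use t0 that in auto)
    \<comment> \<open>The least element \<open>t2\<close> of this compact set is the first time at
      which the height is \<open>x\<close>. Up to then \<open>z t \<ge> x\<close>, which makes the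
      coefficient in the slope bound uniform.\<close>
    define S where "S = {t \<in> {t0..t'}. z t = x}"
    have S_sub: "S \<subseteq> {t0..t'}" by (auto simp: S_def)
    have "\<exists>t. t0 \<le> t \<and> t \<le> t' \<and> z t = x"
      by (rule IVT2') (use t' z0 zc[of t'] in \<open>auto simp: x_def z0_def\<close>)
    then have "S \<noteq> {}" by (auto simp: S_def)
    have "closed S"
      unfolding S_def by (rule continuous_closed_preimage_constant) (use zc t' in auto)
    then have "compact S"
      by (rule compact_Int_closed[OF compact_Icc, of S t0 t', unfolded Int_absorb1[OF S_sub]])
    then obtain t2 where t2: "t2 \<in> S" "\<And>t. t \<in> S \<Longrightarrow> t2 \<le> t"
      using compact_attains_inf[of S] \<open>S \<noteq> {}\<close> by auto
    have t02: "t0 \<le> t2" "t2 < T" "t2 \<le> t'" "z t2 = x" using t2 t' by (auto simp: S_def)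
    have ge: "x \<le> z t" if "t0 \<le> t" "t \<le> t2" for t
    proof (rule ccontr)
      assume "\<not> x \<le> z t"
      then have "\<exists>s. t0 \<le> s \<and> s \<le> t \<and> z s = x"
        using that t02 z0 zc[of t] by (intro IVT2') (auto simp: x_def z0_def)
      then obtain s where s: "t0 \<le> s" "s \<le> t" "z s = x" by auto
      then have "t2 \<le> s" using t2(2)[of s] that t02 by (auto simp: S_def)
      then have "s = t" using s that by auto
      then show False using s \<open>\<not> x \<le> z t\<close> by auto
    qed
    \<comment> \<open>The factor 2 matches the half slope \<open>K / 2\<close> allowed at the
      boundary of the barrier.\<close>
    define K where "K = 2 * (C2 / x powr \<alpha>)"
    have K0: "K > 0" using C2 x0 by (auto simp: K_def)
    have "z0 / 2 - N * K * (t2 - t0) - K / 2 * (r t2)\<^sup>2 \<le> w (r t2) t2"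
    proof (rule height_lower_bound[OF t0(1) t02(2) K0 _ init])
      fix t assume t: "t0 \<le> t" "t \<le> t2"
      then have tT: "t1 \<le> t" "t < T" "0 \<le> t" using t0 t02 by auto
      have "x powr \<alpha> \<le> z t powr \<alpha>"
        using ge[OF t] x0 exps by (intro powr_mono2) auto
      then have "C2 / z t powr \<alpha> \<le> C2 / x powr \<alpha>"
        using C2 x0 z_pos[OF tT(1,2)] by (intro divide_left_mono) auto
      then have "C2 / z t powr \<alpha> * r t \<le> C2 / x powr \<alpha> * r t"
        using r_pos[OF tT(3,2)] by (intro mult_right_mono) auto
      then show "- p (r t) t \<le> K / 2 * r t"
        using slope[OF tT(1,2)] by (auto simp: K_def)
    qed (use t02 t0 r_pos[of t2] in auto)
    moreover have "K / 2 * (r t2)\<^sup>2 \<le> x"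
    proof -
      have "r t2 \<le> D * x powr \<delta>" using radius[of t2] t02 t0 by auto
      then have "(r t2)\<^sup>2 \<le> (D * x powr \<delta>)\<^sup>2"
        using r_pos[of t2] t02 t0 by (intro power_mono) auto
      then have "K / 2 * (r t2)\<^sup>2 \<le> K / 2 * (D * x powr \<delta>)\<^sup>2"
        using K0 by (intro mult_left_mono) auto
      also have "\<dots> = C2 * D\<^sup>2 * (x powr \<delta> * x powr \<delta> / x powr \<alpha>)"
        by (simp add: K_def power_mult_distrib power2_eq_square)
      also have "x powr \<delta> * x powr \<delta> / x powr \<alpha> = x powr (2 * \<delta> - \<alpha> - 1) * x"
        using x0 powr_add[of x "2 * \<delta> - \<alpha> - 1" 1]
        by (simp add: powr_add[symmetric] powr_diff[symmetric])
      also have "x powr (2 * \<delta> - \<alpha> - 1) = (1 / 8) powr (2 * \<delta> - \<alpha> - 1) * z0 powr (2 * \<delta> - \<alpha> - 1)"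
        using powr_mult[of "1 / 8" z0 "2 * \<delta> - \<alpha> - 1"] z0 by (simp add: x_def)
      also have "C2 * D\<^sup>2 * ((1 / 8) powr (2 * \<delta> - \<alpha> - 1) * z0 powr (2 * \<delta> - \<alpha> - 1) * x) =
          (C2 * D\<^sup>2 * (1 / 8) powr (2 * \<delta> - \<alpha> - 1) * z0 powr (2 * \<delta> - \<alpha> - 1)) * x"
        by simp
      also have "\<dots> \<le> 1 * x"
        using elim x0 by (intro mult_right_mono) (auto simp: z0_def)
      finally show ?thesis by simp
    qed
    ultimately have "2 * x \<le> N * K * (t2 - t0)"
      using t02 by (auto simp: z_def x_def)
    also have "\<dots> \<le> N * K * (T - t0)"
      using t02 K0 N by (intro mult_left_mono) auto
    finally have "x * x powr \<alpha> \<le> N * C2 * (T - t0)"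
      using x0 by (simp add: K_def field_simps)
    then have "8 powr (\<alpha> + 1) * (x * x powr \<alpha>) \<le> 8 powr (\<alpha> + 1) * (N * C2 * (T - t0))"
      by (intro mult_left_mono) auto
    moreover have "z0 powr (\<alpha> + 1) = 8 powr (\<alpha> + 1) * (x * x powr \<alpha>)"
      using powr_mult[of 8 x "\<alpha> + 1"] x0 by (simp add: x_def powr_add)
    ultimately show ?case
      by (simp add: z0_def powr_add mult_ac)
  qed
  moreover have "8 * N * C2 * 8 powr \<alpha> > 0" using N C2 by auto
  ultimately show ?thesis by blast
qed

end

subsection \<open>Curvature of a rotationally symmetric graph\<close>

lemma matrix_inv_eqI:
  fixes A B :: "real ^ 'n ^ 'n"
  assumes "A ** B = mat 1" "B ** A = mat 1"
  shows "matrix_inv A = B"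
proof -
  have inv: "A ** matrix_inv A = mat 1 \<and> matrix_inv A ** A = mat 1"
    unfolding matrix_inv_def by (rule someI[of _ B]) (use assms in simp)
  then have "matrix_inv A = (B ** A) ** matrix_inv A"
    by (simp add: assms)
  also have "\<dots> = B"
    using inv by (simp add: matrix_mul_assoc[symmetric])
  finally show ?thesis .
qed

lemma matrix_inv_diagonal:
  fixes g :: "'n::finite \<Rightarrow> real"
  assumes "\<And>i. g i \<noteq> 0"
  shows "matrix_inv (\<chi> i j. if i = j then g i else 0) = (\<chi> i j. if i = j then 1 / g i else 0)"
proof (rule matrix_inv_eqI)
  have "(if i = k then g i else 0) * (if k = j then 1 / g k else 0) =
      (if k = i then if i = j then 1 else 0 else 0)"
    "(if i = k then 1 / g i else 0) * (if k = j then g k else 0) =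
      (if k = i then if i = j then 1 else 0 else 0)" for i j k
    using assms by auto
  then show "(\<chi> i j. if i = j then g i else 0) ** (\<chi> i j. if i = j then 1 / g i else 0) = mat 1"
    "(\<chi> i j. if i = j then 1 / g i else 0) ** (\<chi> i j. if i = j then g i else 0) = mat 1"
    by (simp_all add: matrix_matrix_mult_def mat_def vec_eq_iff)
qed

text \<open>When both fundamental forms are diagonal, the full contraction defining the squared norm
  of the second fundamental form is the sum of the squared principal curvatures
  \<open>a i / g i\<close>.\<close>

lemma sum_diagonal_contraction:
  fixes g a :: "'n::finite \<Rightarrow> real"
  shows "(\<Sum>i\<in>UNIV. \<Sum>j\<in>UNIV. \<Sum>k\<in>UNIV. \<Sum>l\<in>UNIV.
      (if i = k then 1 / g i else 0) * (if j = l then 1 / g j else 0) *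
      (if i = j then a i else 0) * (if k = l then a k else 0)) = (\<Sum>i\<in>UNIV. (a i / g i)\<^sup>2)"
    (is "(\<Sum>i\<in>UNIV. \<Sum>j\<in>UNIV. \<Sum>k\<in>UNIV. \<Sum>l\<in>UNIV. ?X i j k l) = _")
proof (rule sum.cong[OF refl])
  fix i :: 'n
  have X: "?X i j k l = (if l = j then if k = i then if j = i then (a i / g i)\<^sup>2 else 0 else 0 else 0)"
    for j k l by (simp add: power2_eq_square)
  show "(\<Sum>j\<in>UNIV. \<Sum>k\<in>UNIV. \<Sum>l\<in>UNIV. ?X i j k l) = (a i / g i)\<^sup>2"
    unfolding X by (simp only: sum.delta' sum.delta finite UNIV_I if_True)
qed

lemma frechet_derivative_eqI:
  assumes "(f has_derivative f') (at x within S)" "x \<in> interior S"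
  shows "frechet_derivative f (at x within S) = f'"
  using assms frechet_derivative_at[of f f' x] by (metis at_within_interior)

text \<open>On a coordinate axis both fundamental forms are diagonal: direction \<open>k\<close> is
  the meridian, every other direction is tangent to the rotation circle. The left-hand side is the
  square of the rotational curvature in a direction \<open>i \<noteq> k\<close>; the remaining
  squares are dropped.\<close>

lemma curvature_lower_bound:
  fixes f p :: "real \<Rightarrow> real" and i k :: "'n::finite"
  assumes R: "R > 0" and s: "0 < s" "s < 1" and ik: "i \<noteq> k"
    and f: "\<And>y. 0 < y \<Longrightarrow> y < R \<Longrightarrow> (f has_real_derivative p y) (at y)"
    and p: "(p has_real_derivative q) (at (R * s))"
  shows "(p (R * s))\<^sup>2 / ((R * s)\<^sup>2 * (1 + (p (R * s))\<^sup>2)) \<le>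
    second_ff_norm_sq (cball 0 1) (\<lambda>x::real^'n. (R *\<^sub>R x, f (R * norm x))) (axis k s)"
proof -
  let ?S = "cball 0 1 :: (real^'n) set"
  let ?F = "\<lambda>x::real^'n. (R *\<^sub>R x, f (R * norm x))"
  let ?x = "axis k s :: real^'n"
  define P where "P = p (R * s)"
  \<comment> \<open>On this open set the norm is differentiable and derivatives within the disk are
    ordinary ones.\<close>
  define U where "U = ball 0 1 - {0 :: real^'n}"
  have U: "open U" by (simp add: U_def open_Diff)
  have nx: "norm ?x = s"
    using s by (simp add: norm_eq_sqrt_inner inner_axis_axis)
  have x0: "?x \<noteq> 0" using nx s by auto
  have xU: "?x \<in> U" using nx s x0 by (simp add: U_def)
  have UI: "U \<subseteq> interior ?S" by (auto simp: U_def)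
  have radius: "((\<lambda>x. R * norm x) has_derivative (\<lambda>h. R * (h \<bullet> sgn x))) (at x within ?S)"
    if "x \<noteq> 0" for x :: "real^'n"
    by (intro has_derivative_mult_right has_derivative_at_withinI[OF has_derivative_norm[OF that]])
  have D1: "(?F has_derivative (\<lambda>h. (R *\<^sub>R h, (R * (h \<bullet> sgn x)) * p (R * norm x)))) (at x within ?S)"
    if "x \<in> U" for x
  proof -
    have x: "x \<noteq> 0" "0 < R * norm x" "R * norm x < R"
      using that R by (auto simp: U_def)
    have "((\<lambda>x. f (R * norm x)) has_derivative (\<lambda>h. (R * (h \<bullet> sgn x)) * p (R * norm x))) (at x within ?S)"
      by (rule DERIV_compose_FDERIV[where g = "\<lambda>x. R * norm x", OF f[OF x(2,3)] radius[OF x(1)]])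
    then show ?thesis by (intro derivative_intros) auto
  qed
  \<comment> \<open>A second partial derivative needs the first one as a function near the point,
    hence a closed formula valid on all of \<open>U\<close>.\<close>
  define G where "G j x = (R *\<^sub>R axis j 1 :: real^'n, R * (x $ j / norm x) * p (R * norm x))"
    for j :: 'n and x :: "real^'n"
  have d1: "partial_within ?S j ?F x = G j x" if "x \<in> U" for j x
    unfolding partial_within_def frechet_derivative_eqI[OF D1[OF that] set_mp[OF UI that]]
    by (simp add: G_def sgn_div_norm inner_axis inner_commute[of "axis j 1"] divide_inverse mult.commute)
  have D2: "(partial_within ?S j ?F has_derivative
      (\<lambda>h. (0, R * (?x $ j / s) * ((R * (h \<bullet> sgn ?x)) * q) +
        R * ((h $ j * s - ?x $ j * (h \<bullet> sgn ?x)) / (s * s)) * P))) (at ?x within ?S)" for j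
  proof -
    have p_part: "((\<lambda>x. p (R * norm x)) has_derivative (\<lambda>h. (R * (h \<bullet> sgn ?x)) * q)) (at ?x within ?S)"
      by (rule DERIV_compose_FDERIV[where g = "\<lambda>x. R * norm x" and f = p, OF _ radius[OF x0]])
        (simp add: nx p)
    have "((\<lambda>x. x $ j / norm x) has_derivative
        (\<lambda>h. (h $ j * s - ?x $ j * (h \<bullet> sgn ?x)) / (s * s))) (at ?x within ?S)"
      using has_derivative_divide'[OF bounded_linear_imp_has_derivative[OF bounded_linear_vec_nth]
          has_derivative_at_withinI[OF has_derivative_norm[OF x0]], of j "?S"] nx s by simp
    from has_derivative_Pair[OF has_derivative_const
        has_derivative_mult[OF has_derivative_mult_right[OF this] p_part]]
    have "(G j has_derivative
      (\<lambda>h. (0, R * (?x $ j / s) * ((R * (h \<bullet> sgn ?x)) * q) +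
        R * ((h $ j * s - ?x $ j * (h \<bullet> sgn ?x)) / (s * s)) * P))) (at ?x within ?S)"
      unfolding G_def nx P_def .
    then show ?thesis
      by (rule has_derivative_transform_within_open[OF _ U xU]) (simp add: d1)
  qed
  \<comment> \<open>The vertical second derivatives at the axis point: \<open>R * R * q\<close>
    along the meridian, and \<open>R * P / s\<close> along the rotation circle, coming from the
    derivative of \<open>x $ j / norm x\<close>.\<close>
  define a where "a j = (if j = k then R * R * q else R * P / s)" for j
  have sg: "axis j 1 \<bullet> sgn ?x = (if j = k then 1 else 0)" for j
    using s by (auto simp: sgn_div_norm nx inner_axis_axis) 
  have d2: "partial_within ?S l (partial_within ?S j ?F) ?x = (0, if l = j then a j else 0)" for l j
    unfolding partial_within_def[of _ l] frechet_derivative_eqI[OF D2 set_mp[OF UI xU]] sg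
    using s by (auto simp: a_def axis_def field_simps)
  define g where "g j = R\<^sup>2 * (if j = k then 1 + P\<^sup>2 else 1)" for j
  have gx: "G j ?x = (R *\<^sub>R axis j 1, if j = k then R * P else 0)" for j
    unfolding G_def nx P_def using s by (auto simp: axis_def)
  have first: "first_ff ?S ?F ?x = (\<chi> l j. if l = j then g l else 0)"
    unfolding first_ff_def d1[OF xU] gx
    by (auto simp: vec_eq_iff g_def inner_axis_axis power2_eq_square algebra_simps)
  have P1: "1 + P\<^sup>2 > 0" by (simp add: add_pos_nonneg)
  then have sq: "sqrt (1 + P\<^sup>2) > 0" "(sqrt (1 + P\<^sup>2))\<^sup>2 = 1 + P\<^sup>2" by auto
  \<comment> \<open>For uniqueness, orthogonality expresses the horizontal part through the vertical
    one; unit length and the upward sign then fix the latter.\<close>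
  define \<nu> where "\<nu> = ((- P / sqrt (1 + P\<^sup>2)) *\<^sub>R axis k 1 :: real^'n, 1 / sqrt (1 + P\<^sup>2))"
  have normal: "upward_normal ?S ?F ?x = \<nu>"
    unfolding upward_normal_def d1[OF xU] gx
  proof (rule the_equality)
    show "norm \<nu> = 1 \<and> (\<forall>i. \<nu> \<bullet> (R *\<^sub>R axis i 1, if i = k then R * P else 0) = 0) \<and> 0 < snd \<nu>"
      using sq by (auto simp: \<nu>_def norm_Pair inner_axis_axis power_divide
          add_divide_distrib[symmetric] add.commute)
  next
    fix m :: "(real^'n) \<times> real"
    assume m: "norm m = 1 \<and> (\<forall>i. m \<bullet> (R *\<^sub>R axis i 1, if i = k then R * P else 0) = 0) \<and> 0 < snd m"
    obtain b c where bc: "m = (b, c)" by (cases m)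
    have "R * (b $ j) + (if j = k then R * P * c else 0) = 0" for j
      using m[THEN conjunct2, THEN conjunct1, THEN spec, of j]
      by (simp add: bc inner_axis ac_simps split: if_splits)
    then have "R * (b $ j + (if j = k then P * c else 0)) = 0" for j
      by (simp add: distrib_left mult.assoc if_distrib cong: if_cong)
    then have bj: "b $ j + (if j = k then P * c else 0) = 0" for j
      using R by simp
    have bj: "b $ j = (if j = k then - P * c else 0)" for j
      using bj[of j] by (simp split: if_splits)
    then have b: "b = (- P * c) *\<^sub>R axis k 1"
      by (auto simp: vec_eq_iff axis_def)
    have "1 = (norm m)\<^sup>2" using m by simp
    also have "\<dots> = (1 + P\<^sup>2) * c\<^sup>2"
      by (simp add: bc norm_Pair b power_mult_distrib algebra_simps)
    finally have "(sqrt (1 + P\<^sup>2) * c)\<^sup>2 = 1\<^sup>2"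
      using sq by (simp add: power_mult_distrib)
    then have "sqrt (1 + P\<^sup>2) * c = 1"
      by (rule power2_eq_imp_eq) (use m sq in \<open>auto simp: bc\<close>)
    then have "c = 1 / sqrt (1 + P\<^sup>2)" using sq by (simp add: field_simps)
    then show "m = \<nu>" by (simp add: bc b \<nu>_def)
  qed
  have second: "second_ff ?S ?F ?x = (\<chi> l j. if l = j then a l / sqrt (1 + P\<^sup>2) else 0)"
    unfolding second_ff_def normal d2 by (auto simp: vec_eq_iff \<nu>_def)
  have g0: "g j \<noteq> 0" for j using R P1 by (auto simp: g_def)
  have "second_ff_norm_sq ?S ?F ?x = (\<Sum>j\<in>UNIV. (a j / sqrt (1 + P\<^sup>2) / g j)\<^sup>2)"
    unfolding second_ff_norm_sq_def first second matrix_inv_diagonal[OF g0]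
    using sum_diagonal_contraction[of g "\<lambda>j. a j / sqrt (1 + P\<^sup>2)"] by (simp add: Let_def)
  moreover have "(a i / sqrt (1 + P\<^sup>2) / g i)\<^sup>2 \<le> (\<Sum>j\<in>UNIV. (a j / sqrt (1 + P\<^sup>2) / g j)\<^sup>2)"
    by (rule member_le_sum) auto
  moreover have "(a i / sqrt (1 + P\<^sup>2) / g i)\<^sup>2 = P\<^sup>2 / ((R * s)\<^sup>2 * (1 + P\<^sup>2))"
    using ik R sq by (simp add: a_def g_def power_divide power_mult_distrib power2_eq_square)
  ultimately show ?thesis by (simp add: P_def)
qed

subsection \<open>The flow near the pinching point\<close>

lemma connected_nonzero_sign:
  fixes f :: "'a::topological_space \<Rightarrow> real"
  assumes "connected S" "continuous_on S f" "\<And>x. x \<in> S \<Longrightarrow> f x \<noteq> 0"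
  shows "(\<forall>x\<in>S. 0 < f x) \<or> (\<forall>x\<in>S. f x < 0)"
proof (rule ccontr)
  assume "\<not> ?thesis"
  then obtain x y where "x \<in> S" "y \<in> S" "f x \<le> 0" "0 \<le> f y" by (auto simp: not_less)
  then have "0 \<in> f ` S"
    using connectedD_interval[OF connected_continuous_image[OF assms(2,1)], of "f x" "f y" 0] by auto
  then show False using assms(3) by auto
qed

section \<open>From the geometric definitions to the radial flow\<close>

lemma C2_on_open_DERIV:
  assumes "C2_on f S" "open S" "x \<in> S"
  shows "(f has_real_derivative deriv f x) (at x)"
    and "(deriv f has_real_derivative deriv (deriv f) x) (at x)"
proof -
  have diff: "f differentiable (at y)" if "y \<in> S" for y
    using assms that by (auto simp: C2_on_def at_within_open[of _ S])
  then have D: "(f has_real_derivative deriv f y) (at y)" if "y \<in> S" for y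
    using that DERIV_deriv_iff_real_differentiable by blast
  show "(f has_real_derivative deriv f x) (at x)" by (rule D[OF assms(3)])
  have vd: "vector_derivative f (at y within S) = deriv f y" if "y \<in> S" for y
    using D[OF that] at_within_open[OF that assms(2)]
    by (simp add: has_real_derivative_iff_has_vector_derivative vector_derivative_at)
  have "(\<lambda>y. vector_derivative f (at y within S)) differentiable (at x)"
    using assms by (auto simp: C2_on_def C1_on_def at_within_open[of _ S])
  then obtain d where "((\<lambda>y. vector_derivative f (at y within S)) has_real_derivative d) (at x)"
    using real_differentiable_def by blast
  then have "(deriv f has_real_derivative d) (at x)"
    by (rule has_field_derivative_transform_within_open[OF _ assms(2,3)]) (simp add: vd)
  then show "(deriv f has_real_derivative deriv (deriv f) x) (at x)"
    using DERIV_imp_deriv by blast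
qed

text \<open>Taking the derivative within \<open>{0<..r t}\<close> yields a single function that
  agrees with \<open>deriv\<close> inside and is the one-sided slope at the contact circle, where
  \<open>deriv\<close> would depend on values outside the domain.\<close>

definition slope :: "(real \<Rightarrow> real) \<Rightarrow> (real \<Rightarrow> real \<Rightarrow> real) \<Rightarrow> real \<Rightarrow> real \<Rightarrow> real" where
  "slope r \<omega> y t = vector_derivative (\<lambda>\<eta>. \<omega> \<eta> t) (at y within {0<..r t})"

lemma slope_interior:
  assumes "((\<lambda>\<eta>. \<omega> \<eta> t) has_real_derivative d) (at y)" "0 < y" "y < r t"
  shows "slope r \<omega> y t = d"
proof -
  have "at y within {0<..r t} = at y"
    by (rule at_within_open_subset[of y "{0<..<r t}"]) (use assms in auto)
  then show ?thesis
    using assms(1)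
    by (simp add: slope_def has_real_derivative_iff_has_vector_derivative vector_derivative_at)
qed

text \<open>After the nonzero normalising factors are cancelled, orthogonality of
  \<open>(- p, 1)\<close> and \<open>(1, - d)\<close> reads \<open>- p - d = 0\<close>.\<close>

lemma free_boundary_slope:
  assumes "free_boundary \<omega>\<Sigma> (r t) (\<lambda>y. \<omega> y t)"
  shows "slope r \<omega> (r t) t = - deriv \<omega>\<Sigma> (\<omega> (r t) t)" and "r t = \<omega>\<Sigma> (\<omega> (r t) t)"
proof -
  define p where "p = slope r \<omega> (r t) t"
  define d where "d = deriv \<omega>\<Sigma> (\<omega> (r t) t)"
  have pos: "sqrt (1 + x\<^sup>2) \<noteq> 0" for x :: real
    by (smt (verit) real_sqrt_eq_zero_cancel zero_le_power2)
  have "(1 / sqrt (1 + p\<^sup>2)) * ((1 / sqrt (1 + d\<^sup>2)) * (- p - d)) = 0"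
    using assms unfolding free_boundary_def graph_normal_def normal_Sigma_def p_def d_def slope_def
    by (simp add: algebra_simps)
  then have "- p - d = 0" using pos by auto
  then show "slope r \<omega> (r t) t = - deriv \<omega>\<Sigma> (\<omega> (r t) t)"
    by (simp add: p_def d_def)
  show "r t = \<omega>\<Sigma> (\<omega> (r t) t)"
    using assms by (simp add: free_boundary_def)
qed

lemma free_boundary_mcf_slope:
  assumes flow: "free_boundary_mcf n \<omega>\<Sigma> T r \<omega>" and t: "0 \<le> t" "t < T"
  shows "0 < y \<Longrightarrow> y < r t \<Longrightarrow> slope r \<omega> y t = deriv (\<lambda>\<eta>. \<omega> \<eta> t) y"
    and "0 < y \<Longrightarrow> y < r t \<Longrightarrow> ((\<lambda>\<eta>. \<omega> \<eta> t) has_real_derivative slope r \<omega> y t) (at y)"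
    and "0 < y \<Longrightarrow> y < r t \<Longrightarrow>
      ((\<lambda>\<eta>. slope r \<omega> \<eta> t) has_real_derivative deriv (deriv (\<lambda>\<eta>. \<omega> \<eta> t)) y) (at y)"
    and "continuous_on {0<..r t} (\<lambda>y. slope r \<omega> y t)"
    and "((\<lambda>\<eta>. \<omega> \<eta> t) has_real_derivative slope r \<omega> (r t) t) (at (r t) within {0<..r t})"
proof -
  have r: "0 < r t" and C1: "C1_on (\<lambda>y. \<omega> y t) {0<..r t}" and C2: "C2_on (\<lambda>y. \<omega> y t) {0<..<r t}"
    using flow t unfolding free_boundary_mcf_def by auto
  note D = C2_on_open_DERIV[OF C2 open_greaterThanLessThan]
  have slope: "slope r \<omega> y t = deriv (\<lambda>\<eta>. \<omega> \<eta> t) y" if "0 < y" "y < r t" for y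
    by (rule slope_interior) (use D(1)[of y] that in auto)
  then show "0 < y \<Longrightarrow> y < r t \<Longrightarrow> slope r \<omega> y t = deriv (\<lambda>\<eta>. \<omega> \<eta> t) y" .
  show "0 < y \<Longrightarrow> y < r t \<Longrightarrow> ((\<lambda>\<eta>. \<omega> \<eta> t) has_real_derivative slope r \<omega> y t) (at y)"
    using D(1)[of y] slope by simp
  show "0 < y \<Longrightarrow> y < r t \<Longrightarrow>
      ((\<lambda>\<eta>. slope r \<omega> \<eta> t) has_real_derivative deriv (deriv (\<lambda>\<eta>. \<omega> \<eta> t)) y) (at y)"
    by (rule has_field_derivative_transform_within_open[OF D(2) open_greaterThanLessThan])
      (use slope in auto)
  show "continuous_on {0<..r t} (\<lambda>y. slope r \<omega> y t)"
    using C1 by (simp add: C1_on_def slope_def)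
  have "(\<lambda>\<eta>. \<omega> \<eta> t) differentiable (at (r t) within {0<..r t})"
    using C1 r by (auto simp: C1_on_def)
  then show "((\<lambda>\<eta>. \<omega> \<eta> t) has_real_derivative slope r \<omega> (r t) t) (at (r t) within {0<..r t})"
    by (simp add: vector_derivative_works has_real_derivative_iff_has_vector_derivative slope_def)
qed

text \<open>The equation is odd in \<open>\<omega>\<close>, since the slope enters its denominator
  squared. Reflection by \<open>\<sigma>\<close> therefore reduces both signs of the contact height
  to one locale.\<close>

lemma free_boundary_mcf_radial_flow:
  assumes flow: "free_boundary_mcf n \<omega>\<Sigma> T r \<omega>" and n: "n \<ge> 2"
    and \<sigma>: "\<sigma> = 1 \<or> \<sigma> = -1"
    and mono: "\<And>t. 0 \<le> t \<Longrightarrow> t < T \<Longrightarrow> 0 < \<sigma> * deriv \<omega>\<Sigma> (\<omega> (r t) t)"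
  shows "radial_flow (real n) T r (\<lambda>y t. \<sigma> * \<omega> y t) (\<lambda>y t. \<sigma> * slope r \<omega> y t)
    (\<lambda>y t. \<sigma> * deriv (deriv (\<lambda>\<eta>. \<omega> \<eta> t)) y)"
proof -
  note slope = free_boundary_mcf_slope[OF flow]
  note flow = flow[unfolded free_boundary_mcf_def]
  have rpos: "0 < r t" if "0 \<le> t" "t < T" for t using flow that by auto
  show ?thesis
  proof
    show "1 < real n" using n by auto
    show "0 < r t" if "0 \<le> t" "t < T" for t by (rule rpos[OF that])
    show "continuous_on {0..<T} r" using flow by auto
    have "continuous_on {(y, t). 0 \<le> y \<and> y \<le> r t \<and> 0 \<le> t \<and> t < T} (\<lambda>(y, t). \<omega> y t)"
      using flow by blast
    then show "continuous_on {(y, t). 0 \<le> y \<and> y \<le> r t \<and> 0 \<le> t \<and> t < T} (\<lambda>(y, t). \<sigma> * \<omega> y t)"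
      unfolding case_prod_unfold by (intro continuous_on_mult_left)
    fix t assume t: "0 \<le> t" "t < T"
    show "((\<lambda>\<eta>. \<sigma> * \<omega> \<eta> t) has_real_derivative \<sigma> * slope r \<omega> y t) (at y)"
      if "0 < y" "y < r t" for y
      by (rule DERIV_cmult[OF slope(2)[OF t that]])
    show "((\<lambda>\<eta>. \<sigma> * slope r \<omega> \<eta> t) has_real_derivative \<sigma> * deriv (deriv (\<lambda>\<eta>. \<omega> \<eta> t)) y) (at y)"
      if "0 < y" "y < r t" for y
      by (rule DERIV_cmult[OF slope(3)[OF t that]])
    show "((\<lambda>s. \<sigma> * \<omega> y s) has_real_derivative
        \<sigma> * deriv (deriv (\<lambda>\<eta>. \<omega> \<eta> t)) y / (1 + (\<sigma> * slope r \<omega> y t)\<^sup>2) +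
        (real n - 1) / y * (\<sigma> * slope r \<omega> y t)) (at t within {0..<T})"
      if "0 < y" "y < r t" for y
    proof -
      have "((\<lambda>s. \<omega> y s) has_real_derivative
           (deriv (deriv (\<lambda>\<eta>. \<omega> \<eta> t)) y * (1 / (1 + (slope r \<omega> y t)\<^sup>2))
            + (real n - 1) / y * slope r \<omega> y t)) (at t within {0..<T})"
        using flow t that slope(1)[OF t that] by auto
      from DERIV_cmult[OF this, of \<sigma>] show ?thesis
        using \<sigma> by (auto simp: algebra_simps)
    qed
    show "((\<lambda>\<eta>. \<sigma> * \<omega> \<eta> t) has_real_derivative \<sigma> * slope r \<omega> (r t) t)
        (at (r t) within {0<..r t})"
      by (rule DERIV_cmult[OF slope(5)[OF t]])
    show "continuous_on {0<..r t} (\<lambda>y. \<sigma> * slope r \<omega> y t)"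
      by (rule continuous_on_mult_left[OF slope(4)[OF t]])
    obtain l where l: "((\<lambda>y. 1 / y * deriv (\<lambda>\<eta>. \<omega> \<eta> t) y) \<longlongrightarrow> l) (at_right 0)"
      using flow t by (meson atLeastLessThan_iff)
    \<comment> \<open>The slope is \<open>y\<close> times a quotient with a finite limit, so it
      tends to 0 at the axis.\<close>
    have lim: "((\<lambda>y. \<sigma> * (y * (1 / y * deriv (\<lambda>\<eta>. \<omega> \<eta> t) y))) \<longlongrightarrow> \<sigma> * (0 * l)) (at_right 0)"
      by (intro tendsto_intros l)
    have "\<forall>\<^sub>F y in at_right 0. 0 < y \<and> y < r t"
      using eventually_at_right_field rpos[OF t] by blast
    then have "\<forall>\<^sub>F y in at_right 0.
        \<sigma> * (y * (1 / y * deriv (\<lambda>\<eta>. \<omega> \<eta> t) y)) = \<sigma> * slope r \<omega> y t"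
      by eventually_elim (use slope(1)[OF t] in auto)
    from Lim_transform_eventually[OF lim this]
    show "((\<lambda>y. \<sigma> * slope r \<omega> y t) \<longlongrightarrow> 0) (at_right 0)"
      by simp
    show "\<sigma> * slope r \<omega> (r t) t < 0"
      using mono[OF t] free_boundary_slope(1)[of \<omega>\<Sigma> r t \<omega>] flow t by auto
  qed
qed

text \<open>If \<open>\<alpha> < 1\<close>, the bound on \<open>(ln b)'\<close> is integrable at \<open>0\<close>, so \<open>b\<close> cannot vanish there.\<close>

lemma pinching_exponent_ge_1:
  fixes b b' :: "real \<Rightarrow> real"
  assumes lim: "(b \<longlongrightarrow> 0) (at_right 0)" and "e > 0" "C > 0"
    and pos: "\<And>z. 0 < z \<Longrightarrow> z < e \<Longrightarrow> 0 < b z"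
    and deriv: "\<And>z. 0 < z \<Longrightarrow> z < e \<Longrightarrow> (b has_real_derivative b' z) (at z)"
    and bound: "\<And>z. 0 < z \<Longrightarrow> z < e \<Longrightarrow> b' z / b z \<le> C / z powr \<alpha>"
  shows "\<alpha> \<ge> 1"
proof (rule ccontr)
  assume "\<not> \<alpha> \<ge> 1"
  then have \<alpha>: "1 - \<alpha> > 0" by simp
  \<comment> \<open>Subtracting an antiderivative of the bound makes \<open>g\<close> nonincreasing,
    so to the left of \<open>c\<close> it is at least \<open>g c\<close>. The subtracted term is
    nonnegative, hence \<open>ln (b z)\<close> has the same lower bound.\<close>
  define g where "g z = ln (b z) - C / (1 - \<alpha>) * z powr (1 - \<alpha>)" for z
  define c where "c = e / 2"
  have c: "0 < c" "c < e" using \<open>e > 0\<close> by (auto simp: c_def)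
  have g': "(g has_real_derivative b' z / b z - C / z powr \<alpha>) (at z)" if "0 < z" "z < e" for z
  proof -
    have "(g has_real_derivative 1 / b z * b' z - C / (1 - \<alpha>) * ((1 - \<alpha>) * z powr (1 - \<alpha> - 1))) (at z)"
      unfolding g_def
      by (intro DERIV_diff DERIV_cmult DERIV_ln_divide[THEN DERIV_chain2] has_real_derivative_powr deriv pos that)
    moreover have "C / (1 - \<alpha>) * ((1 - \<alpha>) * z powr (1 - \<alpha> - 1)) = C / z powr \<alpha>"
      using \<alpha> by (simp add: powr_minus_divide)
    ultimately show ?thesis by simp
  qed
  have lower: "exp (g c) \<le> b z" if z: "0 < z" "z < c" for z
  proof -
    have "g c \<le> g z"
    proof (rule DERIV_nonpos_imp_nonincreasing[of z c g])
      fix y assume "z \<le> y" "y \<le> c"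
      then have "0 < y" "y < e" using z c by auto
      then show "\<exists>d. (g has_real_derivative d) (at y) \<and> d \<le> 0"
        using g'[of y] bound[of y] by (intro exI[of _ "b' y / b y - C / y powr \<alpha>"]) simp
    qed (use z in simp)
    also have "\<dots> \<le> ln (b z)"
      using \<alpha> \<open>C > 0\<close> by (simp add: g_def)
    finally show ?thesis
      using pos[of z] z c by (simp add: ln_ge_iff)
  qed
  have "\<forall>\<^sub>F z in at_right 0. 0 < z \<and> z < c"
    using eventually_at_right_field c by blast
  then have "\<forall>\<^sub>F z in at_right 0. exp (g c) \<le> b z"
    by eventually_elim (use lower in auto)
  then have "exp (g c) \<le> 0"
    by (rule tendsto_lowerbound[OF lim]) simp
  then show False by simp
qed

section \<open>Blow-up rates, singularity types and curvature at the contact circle\<close>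

text \<open>A Type 1 bound would force \<open>c \<le> C * (T - t) powr (\<beta> - 1)\<close>, which
  tends to 0. Type 0 is excluded as a special case of Type 1. The supremum is taken in the extended
  reals so that it is meaningful for unbounded curvature.\<close>

lemma type2_singularityI:
  fixes F :: "real ^ 'n \<Rightarrow> real \<Rightarrow> (real ^ 'n) \<times> real"
  assumes c: "c > 0" and \<beta>: "\<beta> > 1"
    and blowup: "\<forall>\<^sub>F t in at_left T. ereal (c / (T - t) powr \<beta>) \<le> (SUP x\<in>cball 0 1. ereal (A_norm_sq F x t))"
  shows "type2_singularity F T"
proof -
  have not1: "\<not> type1_singularity F T"
  proof
    assume "type1_singularity F T"
    then obtain \<epsilon> C where \<epsilon>: "\<epsilon> > 0"
      and C: "\<And>x t. x \<in> cball 0 1 \<Longrightarrow> t \<in> {T - \<epsilon><..<T} \<Longrightarrow> A_norm_sq F x t \<le> C / (T - t)"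
      unfolding type1_singularity_def by blast
    have "\<forall>\<^sub>F t in at_left T. T - \<epsilon> < t \<and> t < T"
      unfolding eventually_at_left_field by (rule exI[of _ "T - \<epsilon>"]) (use \<epsilon> in auto)
    with blowup have "\<forall>\<^sub>F t in at_left T. c \<le> C * (T - t) powr (\<beta> - 1)"
    proof eventually_elim
      case (elim t)
      have "(SUP x\<in>cball 0 1. ereal (A_norm_sq F x t)) \<le> ereal (C / (T - t))"
        by (rule SUP_least) (use C elim in auto)
      then have "ereal (c / (T - t) powr \<beta>) \<le> ereal (C / (T - t))"
        using elim by order
      then have "c / (T - t) powr \<beta> \<le> C / (T - t)" by simp
      moreover have "(T - t) powr \<beta> > 0" using elim by auto
      ultimately have "c \<le> C / (T - t) * (T - t) powr \<beta>"
        by (simp add: pos_divide_le_eq)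
      also have "\<dots> = C * (T - t) powr (\<beta> - 1)"
        using elim by (simp add: powr_diff)
      finally show ?case .
    qed
    moreover have "((\<lambda>t. C * (T - t) powr (\<beta> - 1)) \<longlongrightarrow> 0) (at_left T)"
    proof (intro tendsto_mult_right_zero tendsto_zero_powrI)
      have "((\<lambda>t. T - t) \<longlongrightarrow> T - T) (at_left T)" by (intro tendsto_intros)
      then show "((\<lambda>t. T - t) \<longlongrightarrow> 0) (at_left T)" by simp
      show "\<forall>\<^sub>F t in at_left T. 0 \<le> T - t"
        by (simp add: eventually_at_filter)
    qed (use \<beta> in \<open>auto intro: tendsto_eq_intros\<close>)
    ultimately have "c \<le> 0"
      using tendsto_lowerbound by (metis trivial_limit_at_left_real)
    then show False using c by simp
  qed
  moreover have "type1_singularity F T" if type0: "type0_singularity F T"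
  proof -
    obtain \<epsilon> C where \<epsilon>: "\<epsilon> > 0"
      and C: "\<And>x t. x \<in> cball 0 1 \<Longrightarrow> t \<in> {T - \<epsilon><..<T} \<Longrightarrow> A_norm_sq F x t \<le> C"
      using type0 unfolding type0_singularity_def by blast
    \<comment> \<open>During the last unit of time \<open>1 \<le> 1 / (T - t)\<close>; the absolute
      value covers a negative \<open>C\<close>.\<close>
    have "A_norm_sq F x t \<le> \<bar>C\<bar> / (T - t)"
      if "x \<in> cball 0 1" "t \<in> {T - min \<epsilon> 1<..<T}" for x t
    proof -
      have "T - t \<le> 1" using that by (auto simp: min_def split: if_splits)
      have "A_norm_sq F x t \<le> \<bar>C\<bar>" using C[of x t] that by (auto simp: min_def split: if_splits)
      also have "\<dots> \<le> \<bar>C\<bar> / (T - t)"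
        using that mult_left_le[OF \<open>T - t \<le> 1\<close>, of "\<bar>C\<bar>"] by (simp add: pos_le_divide_eq)
      finally show ?thesis .
    qed
    then show ?thesis
      unfolding type1_singularity_def using \<epsilon> by (intro exI[of _ "min \<epsilon> 1"] exI[of _ "\<bar>C\<bar>"] conjI ballI) auto
  qed
  ultimately show ?thesis by (auto simp: type2_singularity_def)
qed

text \<open>The rotational curvature involves the slope alone, so continuity of \<open>p\<close> up
  to \<open>R\<close> carries the interior estimate to the contact circle. The dimension hypothesis
  supplies a direction other than the radial one.\<close>

lemma boundary_curvature_le_SUP:
  fixes f p :: "real \<Rightarrow> real"
  assumes dim: "CARD('n::finite) \<ge> 2" and R: "R > 0"
    and f: "\<And>y. 0 < y \<Longrightarrow> y < R \<Longrightarrow> (f has_real_derivative p y) (at y)"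
    and p: "\<And>y. 0 < y \<Longrightarrow> y < R \<Longrightarrow> (p has_real_derivative q y) (at y)"
    and p_cont: "continuous_on {0<..R} p"
  shows "ereal ((p R)\<^sup>2 / (R\<^sup>2 * (1 + (p R)\<^sup>2))) \<le>
    (SUP x\<in>cball 0 1. ereal (second_ff_norm_sq (cball 0 1) (\<lambda>x::real^'n. (R *\<^sub>R x, f (R * norm x))) x))"
    (is "_ \<le> ?sup")
proof -
  obtain i k :: 'n where ik: "i \<noteq> k"
    using dim card_le_Suc0_iff_eq[of "UNIV :: 'n set"] by auto
  (* The boundary point is approached from the interior, where derivatives within the ball are
     ordinary ones. *)
  define \<kappa> where "\<kappa> s = (p (R * s))\<^sup>2 / ((R * s)\<^sup>2 * (1 + (p (R * s))\<^sup>2))" for s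
  have "continuous_on {1/2..1} (\<lambda>s. p (R * s))"
    by (rule continuous_on_compose2[OF p_cont]) (use R in \<open>auto intro!: continuous_intros\<close>)
  moreover have "1 + x\<^sup>2 \<noteq> 0" for x :: real
    by (smt (verit) zero_le_power2)
  ultimately have "continuous_on {1/2..1} \<kappa>"
    unfolding \<kappa>_def using R by (intro continuous_intros) auto
  then have "(\<kappa> \<longlongrightarrow> \<kappa> 1) (at 1 within {1/2..1})"
    by (auto simp: continuous_on_def)
  then have "(\<kappa> \<longlongrightarrow> \<kappa> 1) (at_left 1)"
    by (simp add: at_within_Icc_at_left)
  then have lim: "((\<lambda>s. ereal (\<kappa> s)) \<longlongrightarrow> ereal (\<kappa> 1)) (at_left 1)"
    by (rule tendsto_ereal)
  have "\<forall>\<^sub>F s in at_left 1. (0::real) < s \<and> s < 1"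
    unfolding eventually_at_left_field by (rule exI[of _ 0]) auto
  then have "\<forall>\<^sub>F s in at_left 1. ereal (\<kappa> s) \<le> ?sup"
  proof eventually_elim
    case (elim s)
    have "norm (axis k s :: real^'n) = s"
      using elim by (simp add: norm_eq_sqrt_inner inner_axis_axis)
    then have "(axis k s :: real^'n) \<in> cball 0 1" using elim by simp
    moreover have "\<kappa> s \<le> second_ff_norm_sq (cball 0 1) (\<lambda>x::real^'n. (R *\<^sub>R x, f (R * norm x))) (axis k s)"
      unfolding \<kappa>_def by (rule curvature_lower_bound[OF R _ _ ik f p]) (use elim R in auto)
    ultimately show ?case
      by (intro SUP_upper2[of "axis k s"]) auto
  qed
  then have "ereal (\<kappa> 1) \<le> ?sup"
    by (rule tendsto_upperbound[OF lim]) simp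
  then show ?thesis by (simp add: \<kappa>_def)
qed

section \<open>Assembly of the blow-up estimate\<close>

theorem theorem1p3:
  fixes \<omega>\<Sigma> \<omega>0 r :: "real \<Rightarrow> real"
    and \<omega> :: "real \<Rightarrow> real \<Rightarrow> real"
    and F :: "real ^ 'n \<Rightarrow> real \<Rightarrow> (real ^ 'n) \<times> real"
    and T C\<Sigma> C1 C2 C3 \<alpha> \<delta> :: real
  assumes dim: "CARD('n) \<ge> 2"
    and Sigma: "pinching_cylinder \<omega>\<Sigma>"
    and C_Sigma: "C\<Sigma> \<ge> 0" "graph_condition \<omega>\<Sigma> C\<Sigma>"
    and monotone: "\<And>z. z \<noteq> 0 \<Longrightarrow> z * deriv \<omega>\<Sigma> z > 0"
    and initial: "admissible_data \<omega>\<Sigma> (r 0) \<omega>0"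
    and flow: "maximal_free_boundary_mcf CARD('n) \<omega>\<Sigma> T r \<omega>"
    and start: "\<And>y. 0 < y \<Longrightarrow> y \<le> r 0 \<Longrightarrow> \<omega> y 0 = \<omega>0 y"
    and F: "F = hypersurface r \<omega>"
    and contracts: "uniform_limit (cball 0 1) (\<lambda>t x. F x t) (\<lambda>x. (0, 0)) (at_left T)"
    and constants: "0 < C1" "C1 < C2" "0 < C3" "0 < \<alpha>" "0 < \<delta>" "2 * \<delta> / (\<alpha> + 1) > 1"
    and pinch: "\<forall>\<^sub>F z in at 0.
        C1 / \<bar>z\<bar> powr \<delta> \<le> \<bar>deriv \<omega>\<Sigma> z / \<omega>\<Sigma> z\<bar> \<and>
        \<bar>deriv \<omega>\<Sigma> z / \<omega>\<Sigma> z\<bar> \<le> C2 / \<bar>z\<bar> powr \<alpha> \<and>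
        \<bar>deriv \<omega>\<Sigma> z\<bar> \<le> C3"
  shows "type2_singularity F T \<and>
    (\<exists>C>0. \<forall>\<^sub>F t in at_left T.
       ereal (C / (T - t) powr (2 * \<delta> / (\<alpha> + 1))) \<le> (SUP x\<in>cball 0 1. ereal (A_norm_sq F x t)))"
proof -
  define \<beta> where "\<beta> = 2 * \<delta> / (\<alpha> + 1)"
  define z where "z t = \<omega> (r t) t" for t
  have flow': "free_boundary_mcf CARD('n) \<omega>\<Sigma> T r \<omega>"
    using flow by (simp add: maximal_free_boundary_mcf_def)
  have T: "0 < T" and r_pos: "\<And>t. 0 \<le> t \<Longrightarrow> t < T \<Longrightarrow> 0 < r t" and r_cont: "continuous_on {0..<T} r"
    and \<omega>_cont: "continuous_on {(y, t). 0 \<le> y \<and> y \<le> r t \<and> 0 \<le> t \<and> t < T} (\<lambda>(y, t). \<omega> y t)"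
    and bdry: "\<And>t. 0 \<le> t \<Longrightarrow> t < T \<Longrightarrow> free_boundary \<omega>\<Sigma> (r t) (\<lambda>y. \<omega> y t)"
    using flow' by (auto simp: free_boundary_mcf_def)
  have b_cont: "continuous_on UNIV \<omega>\<Sigma>" and b_nonneg: "\<And>z. 0 \<le> \<omega>\<Sigma> z"
    and b_zero: "\<And>z. \<omega>\<Sigma> z = 0 \<longleftrightarrow> z = 0"
    using Sigma by (auto simp: pinching_cylinder_def)
  have b_pos: "0 < \<omega>\<Sigma> z" if "z \<noteq> 0" for z
    using b_nonneg[of z] b_zero[of z] that by simp
  have b_deriv: "(\<omega>\<Sigma> has_real_derivative deriv \<omega>\<Sigma> z) (at z)" if "z \<noteq> 0" for z
  proof -
    have "((deriv ^^ 0) \<omega>\<Sigma>) field_differentiable (at z)"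
      using Sigma that unfolding pinching_cylinder_def smooth_on_def by blast
    then show ?thesis by (simp add: field_differentiable_derivI)
  qed
  have r_eq: "r t = \<omega>\<Sigma> (z t)" and slope_eq: "slope r \<omega> (r t) t = - deriv \<omega>\<Sigma> (z t)"
    if "0 \<le> t" "t < T" for t
    unfolding z_def by (rule free_boundary_slope[of \<omega>\<Sigma> r t \<omega>, OF bdry[OF that]])+
  \<comment> \<open>A zero contact height would put the boundary at the pinching point, where the
    radius is 0. By continuity the height keeps one sign, which \<open>\<sigma>\<close>
    records.\<close>
  have z_nz: "z t \<noteq> 0" if "0 \<le> t" "t < T" for t
    using r_eq[OF that] r_pos[OF that] b_zero[of "z t"] by linarith
  have "continuous_on {0..<T} z"
    unfolding z_def[abs_def]
    using continuous_on_compose2[OF \<omega>_cont continuous_on_Pair[OF r_cont continuous_on_id]] r_pos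
    by (simp add: image_subset_iff less_imp_le)
  then have "(\<forall>t\<in>{0..<T}. 0 < z t) \<or> (\<forall>t\<in>{0..<T}. z t < 0)"
    by (intro connected_nonzero_sign) (use z_nz in auto)
  then obtain \<sigma> :: real where \<sigma>: "\<sigma> = 1 \<or> \<sigma> = -1" "\<And>t. 0 \<le> t \<Longrightarrow> t < T \<Longrightarrow> \<sigma> * z t = \<bar>z t\<bar>"
  proof
    assume "\<forall>t\<in>{0..<T}. 0 < z t"
    then show thesis by (intro that[of 1]) (simp_all add: abs_of_pos)
  next
    assume "\<forall>t\<in>{0..<T}. z t < 0"
    then show thesis by (intro that[of "-1"]) (simp_all add: abs_of_neg)
  qed
  have \<sigma>_deriv: "\<sigma> * deriv \<omega>\<Sigma> (z t) = \<bar>deriv \<omega>\<Sigma> (z t)\<bar>" if "0 \<le> t" "t < T" for t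
    using \<sigma>(1) \<sigma>(2)[OF that] monotone[OF z_nz[OF that]] z_nz[OF that]
    by (auto simp: abs_if zero_less_mult_iff split: if_splits)
  interpret radial_flow "real CARD('n)" T r "\<lambda>y t. \<sigma> * \<omega> y t" "\<lambda>y t. \<sigma> * slope r \<omega> y t"
      "\<lambda>y t. \<sigma> * deriv (deriv (\<lambda>\<eta>. \<omega> \<eta> t)) y"
  proof (rule free_boundary_mcf_radial_flow[OF flow' dim \<sigma>(1)])
    fix t assume t: "0 \<le> t" "t < T"
    show "0 < \<sigma> * deriv \<omega>\<Sigma> (\<omega> (r t) t)"
      using \<sigma>_deriv[OF t] monotone[OF z_nz[OF t]] by (auto simp: z_def[symmetric])
  qed

  obtain e where e: "e > 0" and near: "\<And>z. z \<noteq> 0 \<Longrightarrow> \<bar>z\<bar> < e \<Longrightarrow>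
        C1 / \<bar>z\<bar> powr \<delta> \<le> \<bar>deriv \<omega>\<Sigma> z / \<omega>\<Sigma> z\<bar> \<and>
        \<bar>deriv \<omega>\<Sigma> z / \<omega>\<Sigma> z\<bar> \<le> C2 / \<bar>z\<bar> powr \<alpha> \<and> \<bar>deriv \<omega>\<Sigma> z\<bar> \<le> C3"
    using pinch unfolding eventually_at by (auto simp: dist_real_def)
  \<comment> \<open>Combined with \<open>2 * \<delta> > \<alpha> + 1\<close> this yields
    \<open>\<delta> > 1\<close>, which the decay estimate for the height requires.\<close>
  have "\<alpha> \<ge> 1"
  proof (rule pinching_exponent_ge_1[of \<omega>\<Sigma> e C2 "deriv \<omega>\<Sigma>"])
    have "isCont \<omega>\<Sigma> 0" using b_cont by (simp add: continuous_on_eq_continuous_at)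
    then show "(\<omega>\<Sigma> \<longlongrightarrow> 0) (at_right 0)"
      using b_zero[of 0] by (auto simp: isCont_def intro: filterlim_mono[OF _ order_refl at_le])
    show "deriv \<omega>\<Sigma> z / \<omega>\<Sigma> z \<le> C2 / z powr \<alpha>" if "0 < z" "z < e" for z
      using near[of z] that by (simp del: abs_divide add: abs_le_iff)
  qed (use e constants b_pos b_deriv in auto)
  have \<delta>2: "2 * \<delta> > \<alpha> + 1" using constants by (simp add: pos_less_divide_eq)
  then have \<delta>1: "\<delta> > 1" using \<open>\<alpha> \<ge> 1\<close> by simp

  \<comment> \<open>Any boundary point of the disk serves: its image has height \<open>z t\<close>,
    so contraction to the origin gives \<open>z t\<close> tending to 0.\<close>
  let ?x = "axis undefined 1 :: real^'n"
  have "norm ?x = 1"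
    by (simp add: norm_eq_sqrt_inner inner_axis_axis)
  then have "((\<lambda>t. snd (F ?x t)) \<longlongrightarrow> snd (0 :: real^'n, 0::real)) (at_left T)"
    by (intro tendsto_snd tendsto_uniform_limitI[OF contracts]) simp
  then have z_lim: "(z \<longlongrightarrow> 0) (at_left T)"
    using \<open>norm ?x = 1\<close> by (simp add: F hypersurface_def z_def[abs_def])
  have "\<forall>\<^sub>F t in at_left T. \<bar>z t\<bar> < e"
    using order_tendstoD(2)[OF tendsto_rabs[OF z_lim]] e by simp
  then obtain b where b: "b < T" "\<And>t. b < t \<Longrightarrow> t < T \<Longrightarrow> \<bar>z t\<bar> < e"
    unfolding eventually_at_left_field by auto
  define t1 where "t1 = (max 0 b + T) / 2"
  have t1: "0 \<le> t1" "b < t1" "t1 < T"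
    using b T by (auto simp: t1_def)
  have bounds: "C1 / \<bar>z t\<bar> powr \<delta> \<le> \<bar>deriv \<omega>\<Sigma> (z t)\<bar> / r t"
      "\<bar>deriv \<omega>\<Sigma> (z t)\<bar> / r t \<le> C2 / \<bar>z t\<bar> powr \<alpha>" "\<bar>deriv \<omega>\<Sigma> (z t)\<bar> \<le> C3"
      "0 < r t" "0 < \<bar>z t\<bar>"
    if "t1 \<le> t" "t < T" for t
  proof -
    have t: "0 \<le> t" "t < T" "b < t" using that t1 by auto
    show "0 < r t" "0 < \<bar>z t\<bar>" using r_pos z_nz t by auto
    then show "C1 / \<bar>z t\<bar> powr \<delta> \<le> \<bar>deriv \<omega>\<Sigma> (z t)\<bar> / r t"
      "\<bar>deriv \<omega>\<Sigma> (z t)\<bar> / r t \<le> C2 / \<bar>z t\<bar> powr \<alpha>" "\<bar>deriv \<omega>\<Sigma> (z t)\<bar> \<le> C3"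
      using near[OF z_nz[OF t(1,2)] b(2)[OF t(3,2)]] r_eq[OF t(1,2)] by (auto simp: abs_divide)
  qed

  have "\<exists>C>0. \<forall>\<^sub>F t in at_left T. (\<sigma> * \<omega> (r t) t) powr (\<alpha> + 1) \<le> C * (T - t)"
  \<comment> \<open>The constant \<open>C3 / C1\<close> arises by dividing
    \<open>\<bar>deriv \<omega>\<Sigma> (z t)\<bar> \<le> C3\<close> by the lower pinching bound,
    with \<open>\<omega>\<Sigma> (z t) = r t\<close>.\<close>
  proof (rule height_rate[where ?t1.0 = t1 and ?C2.0 = C2 and D = "C3 / C1" and \<delta> = \<delta>])
    show "((\<lambda>t. \<sigma> * \<omega> (r t) t) \<longlongrightarrow> 0) (at_left T)"
      using tendsto_mult_right_zero[OF z_lim, of \<sigma>] by (simp add: z_def)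
    fix t assume t: "t1 \<le> t" "t < T"
    then have t': "0 \<le> t" "t < T" using t1 by auto
    note bt = bounds[OF t]
    have h: "\<sigma> * \<omega> (r t) t = \<bar>z t\<bar>" using \<sigma>(2)[OF t'] by (simp add: z_def)
    show "0 < \<sigma> * \<omega> (r t) t" using h bt by simp
    show "- (\<sigma> * slope r \<omega> (r t) t) \<le> C2 / (\<sigma> * \<omega> (r t) t) powr \<alpha> * r t"
      using bt(2,4) \<sigma>_deriv[OF t'] slope_eq[OF t'] by (simp add: h pos_divide_le_eq)
    have "C1 / \<bar>z t\<bar> powr \<delta> * r t \<le> \<bar>deriv \<omega>\<Sigma> (z t)\<bar>"
      using bt(1,4) by (simp add: pos_le_divide_eq)
    also have "\<dots> \<le> C3" by (rule bt(3))
    finally have "C1 * r t / \<bar>z t\<bar> powr \<delta> \<le> C3" by simp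
    then have "C1 * r t \<le> C3 * \<bar>z t\<bar> powr \<delta>"
      using bt(5) by (subst (asm) pos_divide_le_eq) auto
    then show "r t \<le> C3 / C1 * (\<sigma> * \<omega> (r t) t) powr \<delta>"
      using constants(1) by (simp add: h field_simps)
  qed (use t1 constants \<delta>1 \<delta>2 in auto)
  then obtain C where C: "C > 0"
    "\<forall>\<^sub>F t in at_left T. (\<sigma> * \<omega> (r t) t) powr (\<alpha> + 1) \<le> C * (T - t)" by blast
  \<comment> \<open>The squared rotational curvature is at least
    \<open>C1\<^sup>2 / (1 + C3\<^sup>2)\<close> times the height to the power
    \<open>- 2 * \<delta>\<close>. Since \<open>(\<alpha> + 1) * \<beta> = 2 * \<delta>\<close>,
    raising the height rate to the power \<open>\<beta>\<close> contributes
    \<open>C powr \<beta>\<close>.\<close>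
  define c where "c = C1\<^sup>2 / ((1 + C3\<^sup>2) * C powr \<beta>)"
  have C3: "1 + C3\<^sup>2 > 0" by (simp add: add_pos_nonneg)
  have c: "c > 0" using C C3 constants by (simp add: c_def)
  have "\<forall>\<^sub>F t in at_left T. t1 \<le> t \<and> t < T"
    unfolding eventually_at_left_field by (rule exI[of _ t1]) (use t1 in auto)
  with C(2) have blowup: "\<forall>\<^sub>F t in at_left T.
      ereal (c / (T - t) powr \<beta>) \<le> (SUP x\<in>cball 0 1. ereal (A_norm_sq F x t))"
  proof eventually_elim
    case (elim t)
    then have t: "t1 \<le> t" "t < T" and t': "0 \<le> t" "t < T" using t1 by auto
    note bt = bounds[OF t]
    define d where "d = \<bar>deriv \<omega>\<Sigma> (z t)\<bar>"
    have "\<bar>z t\<bar> powr (\<alpha> + 1) \<le> C * (T - t)"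
      using elim \<sigma>(2)[OF t'] by (simp add: z_def)
    then have "(\<bar>z t\<bar> powr (\<alpha> + 1)) powr \<beta> \<le> (C * (T - t)) powr \<beta>"
      using constants by (intro powr_mono2) (auto simp: \<beta>_def)
    moreover have "(\<bar>z t\<bar> powr (\<alpha> + 1)) powr \<beta> = (\<bar>z t\<bar> powr \<delta>)\<^sup>2"
      using constants bt(5) by (simp add: \<beta>_def powr_powr powr_power mult.commute)
    moreover have "(C * (T - t)) powr \<beta> = C powr \<beta> * (T - t) powr \<beta>"
      using C t by (simp add: powr_mult)
    ultimately have "C1\<^sup>2 / (C powr \<beta> * (T - t) powr \<beta>) \<le> C1\<^sup>2 / (\<bar>z t\<bar> powr \<delta>)\<^sup>2"
      using bt(5) C t by (intro divide_left_mono) auto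
    also have "\<dots> = (C1 / \<bar>z t\<bar> powr \<delta>)\<^sup>2" by (simp add: power_divide)
    also have "\<dots> \<le> (d / r t)\<^sup>2"
      using bt(1) constants(1) unfolding d_def by (intro power_mono) auto
    finally have "C1\<^sup>2 / (C powr \<beta> * (T - t) powr \<beta>) / (1 + C3\<^sup>2) \<le> (d / r t)\<^sup>2 / (1 + C3\<^sup>2)"
      using C3 by (intro divide_right_mono) auto
    also have "d\<^sup>2 \<le> C3\<^sup>2"
      using bt(3) unfolding d_def by (intro power_mono) auto
    then have "(d / r t)\<^sup>2 / (1 + C3\<^sup>2) \<le> (d / r t)\<^sup>2 / (1 + d\<^sup>2)"
      using C3 by (intro divide_left_mono) (auto simp: add_pos_nonneg)
    also have "\<dots> = d\<^sup>2 / ((r t)\<^sup>2 * (1 + d\<^sup>2))" by (simp add: power_divide)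
    finally have le: "c / (T - t) powr \<beta> \<le> d\<^sup>2 / ((r t)\<^sup>2 * (1 + d\<^sup>2))"
      by (simp add: c_def mult_ac)
    have "ereal ((slope r \<omega> (r t) t)\<^sup>2 / ((r t)\<^sup>2 * (1 + (slope r \<omega> (r t) t)\<^sup>2))) \<le>
        (SUP x\<in>cball 0 1. ereal (second_ff_norm_sq (cball 0 1)
          (\<lambda>x::real^'n. (r t *\<^sub>R x, \<omega> (r t * norm x) t)) x))"
      by (rule boundary_curvature_le_SUP[OF dim bt(4), of "\<lambda>y. \<omega> y t" "\<lambda>y. slope r \<omega> y t"])
        (use free_boundary_mcf_slope[OF flow' t'] in auto)
    then have "ereal (d\<^sup>2 / ((r t)\<^sup>2 * (1 + d\<^sup>2))) \<le> (SUP x\<in>cball 0 1. ereal (A_norm_sq F x t))"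
      using slope_eq[OF t'] by (simp add: A_norm_sq_def F hypersurface_def d_def)
    with le show ?case
      by (meson ereal_less_eq(3) order_trans)
  qed
  have "type2_singularity F T"
    by (rule type2_singularityI[OF c _ blowup]) (use constants in \<open>simp add: \<beta>_def\<close>)
  then show ?thesis
    using c blowup unfolding \<beta>_def by blast
qed

end
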